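(* Let $\Gamma$ be a crystallographic group and let $\Pi$, $\mathcal{L}^*$, $R$, $\tau$ be as in the context. Let $W$ be a closed, $\tau$-invariant subspace of $L^2\big(R;l^2(\Pi)\otimes l^2(\mathcal{L}^* )\big)$. Let $\mathcal{A}$ be a countable dense subset of $L^2\big(R;l^2(\Pi)\otimes l^2(\mathcal{L}^* )\big)$, and $J_W^{\mathcal{A}}$ the associated range function. Let $G\in L^2\big(R;l^2(\Pi)\otimes l^2(\mathcal{L}^* )\big)$. Then $G \in W^\perp$ if and only if $G(r) \perp J_W^{\mathcal{A}}(r)$ for almost every $r \in R$. In particular, $W$ satisfies the orthogonality condition: for any $\xi$ in this space, $\xi\perp W$ implies $\xi(r)\perp J_W^{\mathcal{A}}(r)$ for a.e. $r$.
   Context: For $x\in\mathbb{R}^n$ and $L\in \mathrm{GL}(n,\mathbb{R})$, $[x,L]$ denotes the affine map $[x,L]u=L(u+x)$; thus $[x,L][y,M]=[M^{-1}x+y,LM]$. A crystallographic group $\Gamma$ in dimension $n$ is a discrete subgroup of $\{[x,L]:x\in\mathbb{R}^n, L\in \mathrm{O}(n)\}$ with $\mathbb{R}^n/\Gamma$ compact. Its point group is the finite group $\Pi=\{L:[x,L]\in\Gamma\text{ for some }x\}$; its lattice is $\mathcal{L}=\{x:[x,\mathrm{id}]\in\Gamma\}$; the dual lattice is $\mathcal{L}^*=\{z: x\cdot z\in\mathbb{Z}\ \forall x\in\mathcal{L}\}$; and $\Gamma^*=\{[z,M]:z\in\mathcal{L}^*,M\in\Pi\}$, again a crystallographic group.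 Fix a cross-section $\gamma:\Pi\to\Gamma$, $\gamma(M)=[x_M,M]$, with $\gamma(\mathrm{id})=[0,\mathrm{id}]$. $R$ is a fixed fundamental domain for $\Gamma^*$: open, connected, the sets $gR$ ($g\in\Gamma^*$) are mutually disjoint, and $\bigcup_{g\in\Gamma^*} g\overline{R}=\mathbb{R}^n$; moreover $R$ is convex and locally finite. $R$ carries Lebesgue measure. With $\chi_y(u)=e^{2\pi i y\cdot u}$, for $r\in R$ let $U^r$ be the unitary representation of $\Gamma$ on $l^2(\Pi)$ given by $[U^r[x,L]\zeta](M)=\chi_r(x_{L^{-1}M}-x_M+M^{-1}Lx)\zeta(L^{-1}M)$, and let $\tau$ be the unitary representation of $\Gamma$ on $L^2(R;l^2(\Pi)\otimes l^2(\mathcal{L}^* ))$ given by $(\tau[x,L]F)(r)=(U^r[x,L]\otimes I)F(r)$. $W$ is $\tau$-invariant if $\tau[x,L]W\subset W$ for all $[x,L]\in\Gamma$. The range function $J_W^{\mathcal{A}}$: for each $\Phi\in\mathcal{A}$ choose an everywhere-defined representative $f(\Phi)$ of the class $P_W\Phi$ ($P_W$ the orthogonal projection onto $W$), and let $J_W^{\mathcal{A}}(r)$ be the closed linear span of $\{f(\Phi)(r):\Phi\in\mathcal{A}\}$; up to a.e. equality it does not depend on the choice of representatives. *)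

theory Defs
  imports "HOL-Analysis.Analysis" "HOL-Algebra.Group" "HOL-Library.Function_Algebras"
begin

section \<open>Crystallographic groups\<close>

text \<open>The pair \<open>(x, L)\<close> stands for the affine map \<open>[x, L] u = L (u + x)\<close>
  (translate first, then apply \<open>L\<close>).\<close>

type_synonym 'n aff = "(real ^ 'n) \<times> (real ^ 'n ^ 'n)"

definition aff_act :: "'n::finite aff \<Rightarrow> real ^ 'n \<Rightarrow> real ^ 'n" where
  "aff_act g u = snd g *v (u + fst g)"

definition euclidean_group :: "'n::finite aff monoid" where
  "euclidean_group =
    \<lparr> carrier = {(x, L). orthogonal_matrix L},
      mult = (\<lambda>(x, L) (y, M). (matrix_inv M *v x + y, L ** M)),
      one = (0, mat 1) \<rparr>"

definition orbit :: "'n::finite aff set \<Rightarrow> real ^ 'n \<Rightarrow> (real ^ 'n) set" where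
  "orbit \<Gamma> u = (\<lambda>g. aff_act g u) ` \<Gamma>"

definition orbit_space :: "'n::finite aff set \<Rightarrow> (real ^ 'n) set topology" where
  "orbit_space \<Gamma> = topology (\<lambda>\<U>. \<U> \<subseteq> range (orbit \<Gamma>) \<and> open {u. orbit \<Gamma> u \<in> \<U>})"

definition crystallographic :: "'n::finite aff set \<Rightarrow> bool" where
  "crystallographic \<Gamma> \<longleftrightarrow>
     subgroup \<Gamma> euclidean_group \<and> discrete \<Gamma> \<and> compact_space (orbit_space \<Gamma>)"

definition point_group :: "'n::finite aff set \<Rightarrow> (real ^ 'n ^ 'n) set" where
  "point_group \<Gamma> = {L. \<exists>x. (x, L) \<in> \<Gamma>}"

definition lattice_of :: "'n::finite aff set \<Rightarrow> (real ^ 'n) set" where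
  "lattice_of \<Gamma> = {x. (x, mat 1) \<in> \<Gamma>}"

definition dual_lattice :: "'n::finite aff set \<Rightarrow> (real ^ 'n) set" where
  "dual_lattice \<Gamma> = {z. \<forall>x\<in>lattice_of \<Gamma>. x \<bullet> z \<in> \<int>}"

definition dual_group :: "'n::finite aff set \<Rightarrow> 'n aff set" where
  "dual_group \<Gamma> = dual_lattice \<Gamma> \<times> point_group \<Gamma>"

text \<open>A cross-section \<open>\<gamma>(M) = [x\<^sub>M, M]\<close> is given by its translation part \<open>M \<mapsto> x\<^sub>M\<close>.\<close>

definition cross_section ::
    "'n::finite aff set \<Rightarrow> (real ^ 'n ^ 'n \<Rightarrow> real ^ 'n) \<Rightarrow> bool" where
  "cross_section \<Gamma> xs \<longleftrightarrow> (\<forall>M\<in>point_group \<Gamma>. (xs M, M) \<in> \<Gamma>) \<and> xs (mat 1) = 0"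

definition fundamental_domain :: "'n::finite aff set \<Rightarrow> (real ^ 'n) set \<Rightarrow> bool" where
  "fundamental_domain G R \<longleftrightarrow>
     open R \<and> connected R \<and> disjoint_family_on (\<lambda>g. aff_act g ` R) G \<and>
     (\<Union>g\<in>G. aff_act g ` closure R) = UNIV"

definition locally_finite_domain :: "'n::finite aff set \<Rightarrow> (real ^ 'n) set \<Rightarrow> bool" where
  "locally_finite_domain G R \<longleftrightarrow>
     locally_finite_in euclidean ((\<lambda>g. aff_act g ` closure R) ` G)"

lemma orthogonal_matrix_inv:
  fixes M :: "real ^ 'n::finite ^ 'n"
  assumes "orthogonal_matrix M"
  shows "matrix_inv M ** M = mat 1" "M ** matrix_inv M = mat 1"
    "orthogonal_matrix (matrix_inv M)"
proof -
  have "\<exists>N. M ** N = mat 1 \<and> N ** M = mat 1"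
    using assms unfolding orthogonal_matrix_def by blast
  then have "M ** matrix_inv M = mat 1 \<and> matrix_inv M ** M = mat 1"
    unfolding matrix_inv_def by (rule someI_ex)
  then show a: "matrix_inv M ** M = mat 1" and b: "M ** matrix_inv M = mat 1"
    by blast+
  have "matrix_inv M = matrix_inv M ** (M ** transpose M)"
    using assms by (simp add: orthogonal_matrix_def)
  also have "\<dots> = transpose M"
    by (simp add: matrix_mul_assoc a)
  finally show "orthogonal_matrix (matrix_inv M)"
    using assms by simp
qed

lemma aff_act_mult:
  assumes "g \<in> carrier euclidean_group" "h \<in> carrier euclidean_group"
  shows "aff_act (g \<otimes>\<^bsub>euclidean_group\<^esub> h) u = aff_act g (aff_act h u)"
  using assms orthogonal_matrix_inv(2)[of "snd h"]
  by (auto simp: euclidean_group_def aff_act_def case_prod_unfold matrix_vector_mul_assoc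
      matrix_vector_right_distrib matrix_mul_assoc[symmetric] algebra_simps)

lemma group_euclidean_group: "group (euclidean_group :: 'n::finite aff monoid)"
proof (rule groupI)
  have inj: "g = h" if "\<And>u. aff_act g u = aff_act h u" "g \<in> carrier euclidean_group"
      "h \<in> carrier euclidean_group" for g h :: "'n aff"
  proof -
    obtain x L y M where gh: "g = (x, L)" "h = (y, M)"
      by (cases g, cases h)
    have *: "L *v u + L *v x = M *v u + M *v y" for u
      using that(1)[of u] by (simp add: aff_act_def gh matrix_vector_right_distrib)
    from *[of 0] have xy: "L *v x = M *v y"
      by simp
    with * have "L = M"
      by (simp add: matrix_eq)
    moreover have "x = y"
      using arg_cong[OF xy, of "(*v) (matrix_inv L)"] orthogonal_matrix_inv(1)[of L] that(2)
      by (simp add: \<open>L = M\<close> gh euclidean_group_def matrix_vector_mul_assoc)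
    ultimately show ?thesis
      by (simp add: gh)
  qed
  show cl: "g \<otimes>\<^bsub>euclidean_group\<^esub> h \<in> carrier euclidean_group"
    if "g \<in> carrier euclidean_group" "h \<in> carrier euclidean_group" for g h :: "'n aff"
    using that by (auto simp: euclidean_group_def orthogonal_matrix_mul)
  show one: "\<one>\<^bsub>euclidean_group\<^esub> \<in> carrier (euclidean_group :: 'n aff monoid)"
    by (simp add: euclidean_group_def orthogonal_matrix_id)
  show "g \<otimes>\<^bsub>euclidean_group\<^esub> h \<otimes>\<^bsub>euclidean_group\<^esub> k =
      g \<otimes>\<^bsub>euclidean_group\<^esub> (h \<otimes>\<^bsub>euclidean_group\<^esub> k)"
    if "g \<in> carrier euclidean_group" "h \<in> carrier euclidean_group"
      "k \<in> carrier euclidean_group" for g h k :: "'n aff"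
    by (rule inj) (simp_all add: that cl aff_act_mult)
  show "\<one>\<^bsub>euclidean_group\<^esub> \<otimes>\<^bsub>euclidean_group\<^esub> g = g"
    if "g \<in> carrier euclidean_group" for g :: "'n aff"
    by (cases g) (simp add: euclidean_group_def)
  show "\<exists>h\<in>carrier euclidean_group. h \<otimes>\<^bsub>euclidean_group\<^esub> g = \<one>\<^bsub>euclidean_group\<^esub>"
    if g: "g \<in> carrier euclidean_group" for g :: "'n aff"
  proof -
    obtain x L where gx: "g = (x, L)"
      by (cases g)
    have L: "orthogonal_matrix L"
      using g by (simp add: gx euclidean_group_def)
    have "matrix_inv L *v (- (L *v x)) = - x"
      using orthogonal_matrix_inv(1)[OF L]
      by (simp add: linear_neg[OF matrix_vector_mul_linear] matrix_vector_mul_assoc)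
    then show ?thesis
      using orthogonal_matrix_inv[OF L]
      by (intro bexI[of _ "(- (L *v x), matrix_inv L)"]) (auto simp: gx euclidean_group_def)
  qed
qed

lemma openin_orbit_space:
  "openin (orbit_space \<Gamma>) \<U> \<longleftrightarrow> \<U> \<subseteq> range (orbit \<Gamma>) \<and> open {u. orbit \<Gamma> u \<in> \<U>}"
proof -
  have "istopology (\<lambda>\<U>. \<U> \<subseteq> range (orbit \<Gamma>) \<and> open {u. orbit \<Gamma> u \<in> \<U>})"
    unfolding istopology_def
  proof (intro conjI allI impI)
    fix S T
    assume "S \<subseteq> range (orbit \<Gamma>) \<and> open {u. orbit \<Gamma> u \<in> S}"
      "T \<subseteq> range (orbit \<Gamma>) \<and> open {u. orbit \<Gamma> u \<in> T}"
    then show "S \<inter> T \<subseteq> range (orbit \<Gamma>)" "open {u. orbit \<Gamma> u \<in> S \<inter> T}"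
      by (auto simp: Collect_conj_eq)
  next
    fix \<K>
    assume *: "\<forall>K\<in>\<K>. K \<subseteq> range (orbit \<Gamma>) \<and> open {u. orbit \<Gamma> u \<in> K}"
    then show "\<Union> \<K> \<subseteq> range (orbit \<Gamma>)"
      by blast
    have "{u. orbit \<Gamma> u \<in> \<Union> \<K>} = (\<Union>K\<in>\<K>. {u. orbit \<Gamma> u \<in> K})"
      by blast
    then show "open {u. orbit \<Gamma> u \<in> \<Union> \<K>}"
      using * by auto
  qed
  then show ?thesis
    by (simp add: orbit_space_def topology_inverse')
qed

lemma quotient_map_orbit: "quotient_map euclidean (orbit_space \<Gamma>) (orbit \<Gamma>)"
proof -
  have "openin (orbit_space \<Gamma>) (range (orbit \<Gamma>))"
    by (simp add: openin_orbit_space)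
  then have "topspace (orbit_space \<Gamma>) = range (orbit \<Gamma>)"
    by (meson openin_orbit_space openin_subset openin_topspace subset_antisym)
  then show ?thesis
    by (simp add: quotient_map_def openin_orbit_space)
qed


section \<open>Square-summable families and the tensor product\<close>

text \<open>Elements of \<open>l\<^sup>2(I)\<close> are functions on the ambient type that vanish off \<open>I\<close>.\<close>

definition l2 :: "'i set \<Rightarrow> ('i \<Rightarrow> complex) set" where
  "l2 I = {\<xi>. (\<forall>p. p \<notin> I \<longrightarrow> \<xi> p = 0) \<and> (\<lambda>p. (cmod (\<xi> p))\<^sup>2) summable_on I}"

definition l2_inner :: "'i set \<Rightarrow> ('i \<Rightarrow> complex) \<Rightarrow> ('i \<Rightarrow> complex) \<Rightarrow> complex" where
  "l2_inner I \<xi> \<eta> = (\<Sum>\<^sub>\<infinity>p\<in>I. \<xi> p * cnj (\<eta> p))"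

definition l2_norm :: "'i set \<Rightarrow> ('i \<Rightarrow> complex) \<Rightarrow> real" where
  "l2_norm I \<xi> = sqrt (\<Sum>\<^sub>\<infinity>p\<in>I. (cmod (\<xi> p))\<^sup>2)"

definition l2_scale :: "complex \<Rightarrow> ('i \<Rightarrow> complex) \<Rightarrow> 'i \<Rightarrow> complex" where
  "l2_scale c \<xi> = (\<lambda>p. c * \<xi> p)"

lemma vector_space_l2_scale: "vector_space l2_scale"
  by unfold_locales (auto simp: l2_scale_def fun_eq_iff algebra_simps)

definition l2_closure :: "'i set \<Rightarrow> ('i \<Rightarrow> complex) set \<Rightarrow> ('i \<Rightarrow> complex) set" where
  "l2_closure I S = {\<xi> \<in> l2 I. \<forall>e>0. \<exists>\<eta>\<in>S. l2_norm I (\<xi> - \<eta>) < e}"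

definition l2_closed_span :: "'i set \<Rightarrow> ('i \<Rightarrow> complex) set \<Rightarrow> ('i \<Rightarrow> complex) set" where
  "l2_closed_span I S = l2_closure I (module.span l2_scale S)"

text \<open>The Hilbert space tensor product \<open>l\<^sup>2(I) \<otimes> l\<^sup>2(J)\<close> is taken in its standard model
  \<open>l\<^sup>2(I \<times> J)\<close>, with elementary tensors \<open>tensor \<zeta> \<eta>\<close>; the operator \<open>A \<otimes> I\<close> then acts on
  the slices \<open>\<xi>(\<cdot>, z)\<close>.\<close>

definition tensor :: "('i \<Rightarrow> complex) \<Rightarrow> ('j \<Rightarrow> complex) \<Rightarrow> 'i \<times> 'j \<Rightarrow> complex" where
  "tensor \<zeta> \<eta> = (\<lambda>(i, j). \<zeta> i * \<eta> j)"

definition tensor_id ::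
    "(('i \<Rightarrow> complex) \<Rightarrow> 'i \<Rightarrow> complex) \<Rightarrow> ('i \<times> 'j \<Rightarrow> complex) \<Rightarrow> 'i \<times> 'j \<Rightarrow> complex" where
  "tensor_id A \<xi> = (\<lambda>(i, j). A (\<lambda>k. \<xi> (k, j)) i)"

lemma tensor_id_tensor:
  assumes "\<And>c \<zeta>. A (l2_scale c \<zeta>) = l2_scale c (A \<zeta>)"
  shows "tensor_id A (tensor \<zeta> \<eta>) = tensor (A \<zeta>) \<eta>"
proof -
  have "A (\<lambda>k. \<zeta> k * \<eta> j) i = A \<zeta> i * \<eta> j" for i j
    using fun_cong[OF assms[of "\<eta> j" \<zeta>], of i] by (simp add: l2_scale_def mult.commute)
  then show ?thesis
    by (simp add: tensor_id_def tensor_def)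
qed

abbreviation tensor_index :: "'n::finite aff set \<Rightarrow> ((real ^ 'n ^ 'n) \<times> (real ^ 'n)) set" where
  "tensor_index \<Gamma> \<equiv> point_group \<Gamma> \<times> dual_lattice \<Gamma>"


section \<open>Square-integrable vector-valued functions\<close>

text \<open>As usual for \<open>L\<^sup>p\<close> spaces, elements of \<open>L\<^sup>2(R; l\<^sup>2(I))\<close> are represented by
  everywhere-defined functions (only their values on \<open>R\<close> matter), two of which represent the
  same element iff they agree almost everywhere on \<open>R\<close>. Closed sets below are closed
  for the \<open>L\<^sup>2\<close> seminorm, hence are unions of classes modulo a.e. equality. Measurability is
  weak measurability, which agrees with strong measurability if \<open>I\<close> is countable.\<close>

definition L2 :: "'a::euclidean_space set \<Rightarrow> 'i set \<Rightarrow> ('a \<Rightarrow> 'i \<Rightarrow> complex) set" where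
  "L2 R I = {F. (\<forall>r\<in>R. F r \<in> l2 I) \<and>
     (\<forall>\<eta>\<in>l2 I. (\<lambda>r. l2_inner I (F r) \<eta>) \<in> borel_measurable (lebesgue_on R)) \<and>
     integrable (lebesgue_on R) (\<lambda>r. (l2_norm I (F r))\<^sup>2)}"

definition L2_inner ::
    "'a::euclidean_space set \<Rightarrow> 'i set \<Rightarrow> ('a \<Rightarrow> 'i \<Rightarrow> complex) \<Rightarrow> ('a \<Rightarrow> 'i \<Rightarrow> complex) \<Rightarrow> complex" where
  "L2_inner R I F G = (LINT r|lebesgue_on R. l2_inner I (F r) (G r))"

definition L2_norm :: "'a::euclidean_space set \<Rightarrow> 'i set \<Rightarrow> ('a \<Rightarrow> 'i \<Rightarrow> complex) \<Rightarrow> real" where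
  "L2_norm R I F = sqrt (LINT r|lebesgue_on R. (l2_norm I (F r))\<^sup>2)"

definition L2_scale :: "complex \<Rightarrow> ('a \<Rightarrow> 'i \<Rightarrow> complex) \<Rightarrow> 'a \<Rightarrow> 'i \<Rightarrow> complex" where
  "L2_scale c F = (\<lambda>r. l2_scale c (F r))"

lemma vector_space_L2_scale: "vector_space L2_scale"
  by unfold_locales (auto simp: L2_scale_def l2_scale_def fun_eq_iff algebra_simps)

definition L2_closure ::
    "'a::euclidean_space set \<Rightarrow> 'i set \<Rightarrow> ('a \<Rightarrow> 'i \<Rightarrow> complex) set \<Rightarrow> ('a \<Rightarrow> 'i \<Rightarrow> complex) set" where
  "L2_closure R I S = {F \<in> L2 R I. \<forall>e>0. \<exists>H\<in>S. L2_norm R I (F - H) < e}"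

definition L2_closed_subspace ::
    "'a::euclidean_space set \<Rightarrow> 'i set \<Rightarrow> ('a \<Rightarrow> 'i \<Rightarrow> complex) set \<Rightarrow> bool" where
  "L2_closed_subspace R I W \<longleftrightarrow>
     W \<subseteq> L2 R I \<and> module.subspace L2_scale W \<and> L2_closure R I W = W"

definition L2_dense ::
    "'a::euclidean_space set \<Rightarrow> 'i set \<Rightarrow> ('a \<Rightarrow> 'i \<Rightarrow> complex) set \<Rightarrow> bool" where
  "L2_dense R I A \<longleftrightarrow> A \<subseteq> L2 R I \<and> L2_closure R I A = L2 R I"

definition L2_orth ::
    "'a::euclidean_space set \<Rightarrow> 'i set \<Rightarrow> ('a \<Rightarrow> 'i \<Rightarrow> complex) set \<Rightarrow> ('a \<Rightarrow> 'i \<Rightarrow> complex) set" where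
  "L2_orth R I W = {G \<in> L2 R I. \<forall>F\<in>W. L2_inner R I G F = 0}"

text \<open>The set of all representatives of the class \<open>P\<^sub>W \<Phi>\<close>, where \<open>P\<^sub>W\<close> is the orthogonal
  projection onto the closed subspace \<open>W\<close>.\<close>

definition L2_proj ::
    "'a::euclidean_space set \<Rightarrow> 'i set \<Rightarrow> ('a \<Rightarrow> 'i \<Rightarrow> complex) set \<Rightarrow> ('a \<Rightarrow> 'i \<Rightarrow> complex)
      \<Rightarrow> ('a \<Rightarrow> 'i \<Rightarrow> complex) set" where
  "L2_proj R I W \<Phi> = {\<Psi> \<in> W. \<Phi> - \<Psi> \<in> L2_orth R I W}"


section \<open>The representations and range functions\<close>

definition chi :: "'a::euclidean_space \<Rightarrow> 'a \<Rightarrow> complex" where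
  "chi y u = exp (2 * complex_of_real pi * \<i> * complex_of_real (y \<bullet> u))"

definition U_rep ::
    "(real ^ 'n ^ 'n \<Rightarrow> real ^ 'n) \<Rightarrow> real ^ 'n \<Rightarrow> 'n::finite aff
      \<Rightarrow> (real ^ 'n ^ 'n \<Rightarrow> complex) \<Rightarrow> real ^ 'n ^ 'n \<Rightarrow> complex" where
  "U_rep xs r g \<zeta> = (case g of (x, L) \<Rightarrow>
     (\<lambda>M. chi r (xs (matrix_inv L ** M) - xs M + matrix_inv M *v (L *v x)) *
          \<zeta> (matrix_inv L ** M)))"

definition tau_rep ::
    "(real ^ 'n ^ 'n \<Rightarrow> real ^ 'n) \<Rightarrow> 'n::finite aff
      \<Rightarrow> (real ^ 'n \<Rightarrow> (real ^ 'n ^ 'n) \<times> (real ^ 'n) \<Rightarrow> complex)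
      \<Rightarrow> real ^ 'n \<Rightarrow> (real ^ 'n ^ 'n) \<times> (real ^ 'n) \<Rightarrow> complex" where
  "tau_rep xs g F = (\<lambda>r. tensor_id (U_rep xs r g) (F r))"

definition tau_invariant ::
    "'n::finite aff set \<Rightarrow> (real ^ 'n ^ 'n \<Rightarrow> real ^ 'n)
      \<Rightarrow> (real ^ 'n \<Rightarrow> (real ^ 'n ^ 'n) \<times> (real ^ 'n) \<Rightarrow> complex) set \<Rightarrow> bool" where
  "tau_invariant \<Gamma> xs W \<longleftrightarrow> (\<forall>g\<in>\<Gamma>. tau_rep xs g ` W \<subseteq> W)"

text \<open>The range function \<open>J\<^sub>W\<^sup>A\<close> for a choice \<open>f\<close> of representatives,
  \<open>f \<Phi> \<in> L2_proj R I W \<Phi>\<close> for \<open>\<Phi> \<in> A\<close>.\<close>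

definition range_function ::
    "'i set \<Rightarrow> ('b \<Rightarrow> 'a \<Rightarrow> 'i \<Rightarrow> complex) \<Rightarrow> 'b set \<Rightarrow> 'a \<Rightarrow> ('i \<Rightarrow> complex) set" where
  "range_function I f A r = l2_closed_span I ((\<lambda>\<Phi>. f \<Phi> r) ` A)"

definition l2_perp :: "'i set \<Rightarrow> ('i \<Rightarrow> complex) \<Rightarrow> ('i \<Rightarrow> complex) set \<Rightarrow> bool" where
  "l2_perp I \<xi> S \<longleftrightarrow> (\<forall>\<eta>\<in>S. l2_inner I \<xi> \<eta> = 0)"

definition orthogonality_condition ::
    "'a::euclidean_space set \<Rightarrow> 'i set \<Rightarrow> ('a \<Rightarrow> 'i \<Rightarrow> complex) set
      \<Rightarrow> ('a \<Rightarrow> ('i \<Rightarrow> complex) set) \<Rightarrow> bool" where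
  "orthogonality_condition R I W J \<longleftrightarrow>
     (\<forall>\<xi>\<in>L2 R I. \<xi> \<in> L2_orth R I W \<longrightarrow> (AE r in lebesgue_on R. l2_perp I (\<xi> r) (J r)))"

end

theory Submission
  imports Defs
begin

text \<open>
  The substance of the theorem is that orthogonality to \<open>W\<close> in the space of square-integrable
  functions can be checked fibre by fibre. If \<open>\<Psi> \<in> W\<close> and \<open>G \<perp> W\<close>, then for every lattice vector \<open>x\<close>
  the translate \<open>\<tau>[-x, id] \<Psi>\<close> is again in \<open>W\<close>. On pure translations \<open>\<tau>\<close> is diagonal: it multiplies
  the coordinate \<open>(M, z)\<close> of \<open>\<Psi>(r)\<close> by the value at \<open>M r\<close> of the character of the corresponding
  lattice vector. Hence, for all \<open>x\<close> in the lattice,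
    \<open>\<integral>\<^sub>R \<Sum>\<^sub>(\<^sub>M\<^sub>,\<^sub>z\<^sub>) \<chi>\<^sub>x(M r) G(r)(M, z) cnj (\<Psi>(r)(M, z)) dr = 0\<close>.
  This says that all Fourier coefficients of an integrable function on the union of the disjoint
  sets \<open>M R\<close> vanish. That union embeds into the torus of \<open>\<real>\<^sup>n\<close> modulo the dual lattice, because \<open>R\<close> is
  a fundamental domain for the dual group, so the function itself should vanish; summing over
  \<open>(M, z)\<close> gives \<open>\<langle>G(r), \<Psi>(r)\<rangle> = 0\<close> almost everywhere.

  The uniqueness of Fourier coefficients is obtained without a lattice basis. Points that differ
  modulo the dual lattice are separated by characters of the lattice, so Stone--Weierstrass on an infinite
  product of circles, indexed by vectors, shows that two compact sets with no
  common point modulo the dual lattice are separated by a continuous function that is a uniform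
  limit of trigonometric polynomials (\<open>trig_poly_Urysohn\<close>). The displayed identity passes from
  characters to such functions. Given a measurable \<open>E \<subseteq> R\<close>, exhaust \<open>E\<close> and \<open>R - E\<close> by compact
  sets and separate their images under the point group; dominated convergence
  yields \<open>\<integral>\<^sub>E \<langle>G(r), \<Psi>(r)\<rangle> dr = 0\<close>, for every \<open>E\<close> (\<open>AE_orthogonal_if_orbit_chi_null\<close>). Since \<open>A\<close> is
  countable, the exceptional null sets of the functions \<open>f \<Phi>\<close> can be united, and orthogonality to
  the vectors \<open>f \<Phi> r\<close> extends to their closed span.

  Two finiteness facts enter: the point group is finite, so that point-group orbits of compact sets
  are compact, and the dual lattice is countable, so that the fibrewise inner products are
  measurable. Both follow from the disjointness of the translates of the nonempty open set \<open>R\<close>.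

  The converse is soft. If \<open>G(r)\<close> is orthogonal to the range function almost everywhere, then \<open>G\<close>
  is orthogonal to the projection onto \<open>W\<close> of every element of \<open>A\<close>, and these projections are dense
  in \<open>W\<close> (\<open>L2_orth_if_orth_projections\<close>).
\<close>


section \<open>Trigonometric polynomials and periodic separation of compact sets\<close>

lemma open_coordinate_set:
  assumes "open X"
  shows "open {h :: 'a \<Rightarrow> 'b::topological_space. h x \<in> X}"
  using open_vimage[OF assms, of "\<lambda>h :: 'a \<Rightarrow> 'b. h x"] by (simp add: vimage_def)

text \<open>Stone--Weierstrass is stated for Hausdorff types, so the product topology on functions must be
  known to be Hausdorff. The weaker separation classes come first, since the type class system
  requires arities of superclasses to be at least as general.\<close>

instance "fun" :: (type, t0_space) t0_space
proof
  fix f g :: "'a \<Rightarrow> 'b"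
  assume "f \<noteq> g"
  then obtain x where "f x \<noteq> g x" by blast
  then obtain U where "open U" "\<not> (f x \<in> U \<longleftrightarrow> g x \<in> U)"
    using separation_t0[of "f x" "g x"] by blast
  then show "\<exists>U. open U \<and> \<not> (f \<in> U \<longleftrightarrow> g \<in> U)"
    by (intro exI[of _ "{h. h x \<in> U}"]) (simp add: open_coordinate_set)
qed

instance "fun" :: (type, t1_space) t1_space
proof
  fix f g :: "'a \<Rightarrow> 'b"
  assume "f \<noteq> g"
  then obtain x where "f x \<noteq> g x" by blast
  then obtain U where "open U" "f x \<in> U" "g x \<notin> U"
    using separation_t1[of "f x" "g x"] by blast
  then show "\<exists>U. open U \<and> f \<in> U \<and> g \<notin> U"
    by (intro exI[of _ "{h. h x \<in> U}"]) (simp add: open_coordinate_set)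
qed

instance "fun" :: (type, t2_space) t2_space
proof
  fix f g :: "'a \<Rightarrow> 'b"
  assume "f \<noteq> g"
  then obtain x where "f x \<noteq> g x" by blast
  then obtain U V where UV: "open U" "open V" "f x \<in> U" "g x \<in> V" "U \<inter> V = {}"
    by (meson hausdorff)
  then show "\<exists>U V. open U \<and> open V \<and> f \<in> U \<and> g \<in> V \<and> U \<inter> V = {}"
    by (intro exI[of _ "{h. h x \<in> U}"] exI[of _ "{h. h x \<in> V}"])
      (auto simp: open_coordinate_set)
qed

text \<open>The complex span of the characters with frequencies in \<open>L\<close>, in the inductive form that suits
  proofs of linear identities.\<close>

inductive_set trig_poly :: "'a::euclidean_space set \<Rightarrow> ('a \<Rightarrow> complex) set" for L where
  chi: "x \<in> L \<Longrightarrow> chi x \<in> trig_poly L"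
| scale: "t \<in> trig_poly L \<Longrightarrow> (\<lambda>u. c * t u) \<in> trig_poly L"
| add: "s \<in> trig_poly L \<Longrightarrow> t \<in> trig_poly L \<Longrightarrow> (\<lambda>u. s u + t u) \<in> trig_poly L"

lemma chi_zero [simp]: "chi 0 = (\<lambda>u. 1)"
  by (simp add: chi_def fun_eq_iff)

lemma chi_add: "chi (x + y) u = chi x u * chi y u"
  by (simp add: chi_def inner_add_left distrib_left exp_add)

lemma cmod_chi [simp]: "cmod (chi x u) = 1"
  by (simp add: chi_def norm_exp_eq_Re)

lemma cnj_chi: "cnj (chi x u) = chi (- x) u"
  by (simp add: chi_def exp_cnj)

lemma continuous_on_chi [continuous_intros]: "continuous_on S (chi x)"
  unfolding chi_def by (intro continuous_intros)

text \<open>The common kernel of the characters of a lattice is its dual lattice.\<close>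

lemma chi_eq_iff: "chi x u = chi x v \<longleftrightarrow> x \<bullet> (u - v) \<in> \<int>"
proof -
  have "chi x u = chi x v * exp (2 * complex_of_real pi * \<i> * complex_of_real (x \<bullet> (u - v)))"
    by (simp add: chi_def inner_diff_right right_diff_distrib flip: exp_add)
  then have "chi x u = chi x v \<longleftrightarrow> exp (2 * complex_of_real pi * \<i> * complex_of_real (x \<bullet> (u - v))) = 1"
    by (simp add: chi_def)
  also have "\<dots> \<longleftrightarrow> (\<exists>n::int. 2 * pi * (x \<bullet> (u - v)) = 2 * pi * n)"
    unfolding exp_eq_1 by (rule arg_cong2[where f = "(\<and>)", THEN trans]) (auto simp: mult.commute[of _ pi] mult.assoc)
  also have "\<dots> \<longleftrightarrow> x \<bullet> (u - v) \<in> \<int>"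
    by (auto simp: Ints_def)
  finally show ?thesis .
qed

lemma trig_poly_mult:
  assumes L: "\<And>x y. x \<in> L \<Longrightarrow> y \<in> L \<Longrightarrow> x + y \<in> L"
    and s: "s \<in> trig_poly L" and t: "t \<in> trig_poly L"
  shows "(\<lambda>u. s u * t u) \<in> trig_poly L"
  using s
proof induction
  case (chi x)
  from t show ?case
  proof induction
    case (chi y)
    then show ?case
      using trig_poly.chi[OF L[OF \<open>x \<in> L\<close> \<open>y \<in> L\<close>]] by (simp add: chi_add[abs_def])
  next
    case (scale t c)
    then show ?case
      using trig_poly.scale[OF scale.IH, of c] by (simp add: mult.left_commute)
  next
    case (add s t)
    then show ?case
      using trig_poly.add[OF add.IH] by (simp add: distrib_left)
  qed
next
  case (scale s c)
  then show ?case
    using trig_poly.scale[OF scale.IH, of c] by (simp add: mult.assoc)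
next
  case (add r s)
  then show ?case
    using trig_poly.add[OF add.IH] by (simp add: distrib_right)
qed

lemma continuous_trig_poly: "t \<in> trig_poly L \<Longrightarrow> continuous_on UNIV t"
  by (induction rule: trig_poly.induct)
    (simp_all add: continuous_on_chi continuous_on_mult_left continuous_on_add)

lemma bounded_trig_poly: "t \<in> trig_poly L \<Longrightarrow> \<exists>B. \<forall>u. cmod (t u) \<le> B"
proof (induction rule: trig_poly.induct)
  case (chi x)
  show ?case by (intro exI[of _ 1]) simp
next
  case (scale t c)
  then obtain B where "\<And>u. cmod (t u) \<le> B" by blast
  then show ?case
    by (intro exI[of _ "cmod c * B"]) (simp add: norm_mult mult_left_mono)
next
  case (add s t)
  then obtain B C where "\<And>u. cmod (s u) \<le> B" "\<And>u. cmod (t u) \<le> C" by blast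
  then show ?case
    by (intro exI[of _ "B + C"]) (meson add_mono norm_triangle_le)
qed

text \<open>Send \<open>u\<close> to the family of all its character values with frequency in \<open>L\<close>, padded by \<open>1\<close> at
  frequencies outside \<open>L\<close>. The target is a compact Hausdorff product of circles, and by the
  separation hypothesis the images of \<open>C\<close> and \<open>D\<close> are disjoint. Urysohn's lemma gives a separating
  function there, and Stone--Weierstrass approximates it uniformly by polynomials in the real and
  imaginary parts of the coordinates, which pull back to trigonometric polynomials. Because
  the product is compact, the approximation is uniform on the whole space, not only on \<open>C \<union> D\<close>.\<close>

lemma trig_poly_Urysohn:
  fixes L :: "'a::euclidean_space set"
  assumes L: "0 \<in> L" "\<And>x y. x \<in> L \<Longrightarrow> y \<in> L \<Longrightarrow> x + y \<in> L" "\<And>x. x \<in> L \<Longrightarrow> - x \<in> L"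
    and C: "compact C" and D: "compact D"
    and sep: "\<And>c d. c \<in> C \<Longrightarrow> d \<in> D \<Longrightarrow> \<exists>x\<in>L. x \<bullet> (c - d) \<notin> \<int>"
  obtains q :: "'a \<Rightarrow> real"
  where "continuous_on UNIV q" "\<And>u. 0 \<le> q u" "\<And>u. q u \<le> 1"
    "\<And>u. u \<in> C \<Longrightarrow> q u = 1" "\<And>u. u \<in> D \<Longrightarrow> q u = 0"
    "\<And>e. e > 0 \<Longrightarrow> \<exists>t\<in>trig_poly L. \<forall>u. cmod (t u - of_real (q u)) < e"
proof -
  define S :: "('a \<Rightarrow> complex) set" where "S = PiE UNIV (\<lambda>_. sphere 0 1)"
  define \<phi> where "\<phi> u x = (if x \<in> L then chi x u else 1)" for u x :: 'a
  have S: "compact S"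
    using compactin_PiE[of "\<lambda>_. euclidean :: complex topology" UNIV "\<lambda>_::'a. sphere 0 1"]
    by (simp add: S_def euclidean_product_topology)
  have \<phi>S: "\<phi> u \<in> S" for u
    by (auto simp: S_def \<phi>_def PiE_iff)
  have cont: "continuous_on UNIV \<phi>"
  proof (rule continuous_on_coordinatewise_then_product)
    show "continuous_on UNIV (\<lambda>u. \<phi> u x)" for x
      by (cases "x \<in> L") (simp_all add: \<phi>_def continuous_on_chi)
  qed
  have neq: "\<phi> c \<noteq> \<phi> d" if "c \<in> C" "d \<in> D" for c d
  proof -
    obtain x where "x \<in> L" "x \<bullet> (c - d) \<notin> \<int>"
      using sep \<open>c \<in> C\<close> \<open>d \<in> D\<close> by blast
    then have "\<phi> c x \<noteq> \<phi> d x"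
      by (simp add: \<phi>_def chi_eq_iff)
    then show ?thesis by metis
  qed
  have T2: "Hausdorff_space (euclidean :: ('a \<Rightarrow> complex) topology)"
    using hausdorff by (simp add: Hausdorff_space_def disjnt_def) blast
  have normal: "normal_space (top_of_set S)"
    using S by (intro compact_Hausdorff_or_regular_imp_normal_space)
      (auto simp: compact_space_subtopology Hausdorff_space_subtopology T2)
  have img: "compact (\<phi> ` X)" if "compact X" for X
    using that cont by (meson compact_continuous_image continuous_on_subset subset_UNIV)
  have cl: "closedin (top_of_set S) (\<phi> ` X)" if "compact X" for X
    using img[OF that] \<phi>S by (auto intro: closed_subset compact_imp_closed)
  have disj: "disjnt (\<phi> ` C) (\<phi> ` D)"
    unfolding disjnt_iff using neq by blast
  obtain g where g: "continuous_map (top_of_set S) euclideanreal g"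
      "g ` (\<phi> ` C) \<subseteq> {1}" "g ` (\<phi> ` D) \<subseteq> {0}"
    using Urysohn_lemma_alt[OF normal cl[OF C] cl[OF D] disj] by metis
  (* truncation keeps the values 1 on C and 0 on D *)
  define q' where "q' s = max 0 (min 1 (g s))" for s
  have q': "continuous_on S q'"
    using g(1) unfolding q'_def by (auto intro!: continuous_intros)
  define q where "q u = q' (\<phi> u)" for u
  define P where "P h \<longleftrightarrow> continuous_on S h \<and> (\<lambda>u. complex_of_real (h (\<phi> u))) \<in> trig_poly L"
    for h :: "('a \<Rightarrow> complex) \<Rightarrow> real"
  have const: "(\<lambda>u. c) \<in> trig_poly L" for c
    using trig_poly.scale[OF trig_poly.chi[OF L(1)], of c] by simp
  have Re_chi: "(\<lambda>u. complex_of_real (Re (c * chi x u))) \<in> trig_poly L" if "x \<in> L" for x c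
  proof -
    have half: "complex_of_real (Re z) = z / 2 + cnj z / 2" for z
      by (simp add: complex_eq_iff)
    have "(\<lambda>u. (c / 2) * chi x u + (cnj c / 2) * chi (- x) u) \<in> trig_poly L"
      using that L(3) by (intro trig_poly.add trig_poly.scale trig_poly.chi) auto
    then show ?thesis
      unfolding half by (simp add: cnj_chi)
  qed
  show thesis
  proof
    show "continuous_on UNIV q"
      unfolding q_def by (rule continuous_on_compose2[OF q' cont]) (auto simp: \<phi>S)
    show "0 \<le> q u" "q u \<le> 1" for u
      by (auto simp: q_def q'_def)
    show "q u = 1" if "u \<in> C" for u
    proof -
      have "g (\<phi> u) = 1" using g(2) that by blast
      then show ?thesis by (simp add: q_def q'_def)
    qed
    show "q u = 0" if "u \<in> D" for u
    proof -
      have "g (\<phi> u) = 0" using g(3) that by blast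
      then show ?thesis by (simp add: q_def q'_def)
    qed
    fix e :: real assume "e > 0"
    have "\<exists>h. P h \<and> (\<forall>s\<in>S. \<bar>q' s - h s\<bar> < e)"
    proof (rule Stone_Weierstrass_HOL[OF S _ _ _ _ _ q' \<open>e > 0\<close>])
      show "P (\<lambda>s. c)" for c
        by (simp add: P_def const)
      show "P h \<Longrightarrow> continuous_on S h" for h
        by (simp add: P_def)
      show "P h \<and> P k \<Longrightarrow> P (\<lambda>s. h s + k s)" for h k
        by (auto simp: P_def intro: continuous_intros trig_poly.intros)
      show "P h \<and> P k \<Longrightarrow> P (\<lambda>s. h s * k s)" for h k
        by (auto simp: P_def intro: continuous_intros trig_poly_mult[OF L(2)])
      show "\<exists>h. P h \<and> h s \<noteq> h t" if st: "s \<in> S \<and> t \<in> S \<and> s \<noteq> t" for s t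
      proof -
        obtain x where x: "s x \<noteq> t x" using st by blast
        have P: "P (\<lambda>s. Re (c * s x))" for c
        proof -
          have "continuous_on S (\<lambda>s. Re (c * s x))"
            by (intro continuous_intros continuous_on_subset[OF continuous_on_product_coordinates]) auto
          moreover have "(\<lambda>u. complex_of_real (Re (c * \<phi> u x))) \<in> trig_poly L"
            using Re_chi[of x c] const by (cases "x \<in> L") (simp_all add: \<phi>_def)
          ultimately show ?thesis
            by (simp add: P_def)
        qed
        (* Re z and Re (- i z) = Im z together determine z *)
        have "Re (1 * s x) \<noteq> Re (1 * t x) \<or> Re (- \<i> * s x) \<noteq> Re (- \<i> * t x)"
          using x by (simp add: complex_eq_iff)
        then show ?thesis using P by blast
      qed
    qed
    then obtain h where h: "P h" "\<And>s. s \<in> S \<Longrightarrow> \<bar>q' s - h s\<bar> < e"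
      by blast
    then show "\<exists>t\<in>trig_poly L. \<forall>u. cmod (t u - of_real (q u)) < e"
      unfolding P_def q_def
    proof (intro bexI[of _ "\<lambda>u. complex_of_real (h (\<phi> u))"] allI)
      show "cmod (complex_of_real (h (\<phi> u)) - complex_of_real (q' (\<phi> u))) < e" for u
        using h(2)[OF \<phi>S, of u] by (simp only: of_real_diff[symmetric] norm_of_real abs_minus_commute)
    qed auto
  qed
qed

section \<open>Square-summable families\<close>

lemma l2_summable: "\<xi> \<in> l2 I \<Longrightarrow> (\<lambda>p. (cmod (\<xi> p))\<^sup>2) summable_on I"
  by (simp add: l2_def)

lemma l2_norm_squared: "(l2_norm I \<xi>)\<^sup>2 = (\<Sum>\<^sub>\<infinity>p\<in>I. (cmod (\<xi> p))\<^sup>2)"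
  by (simp add: l2_norm_def infsum_nonneg)

lemma l2_inner_self:
  assumes "\<xi> \<in> l2 I"
  shows "l2_inner I \<xi> \<xi> = of_real ((l2_norm I \<xi>)\<^sup>2)"
proof -
  have "((\<lambda>p. complex_of_real ((cmod (\<xi> p))\<^sup>2)) has_sum of_real ((l2_norm I \<xi>)\<^sup>2)) I"
    unfolding l2_norm_squared by (intro has_sum_of_real has_sum_infsum l2_summable assms)
  then show ?thesis
    unfolding l2_inner_def complex_norm_square[symmetric] by (simp add: infsumI)
qed

lemma l2_dominated:
  assumes "\<And>p. p \<notin> I \<Longrightarrow> \<xi> p = 0" "g summable_on I" "\<And>p. p \<in> I \<Longrightarrow> (cmod (\<xi> p))\<^sup>2 \<le> g p"
  shows "\<xi> \<in> l2 I" "(l2_norm I \<xi>)\<^sup>2 \<le> infsum g I"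
proof -
  have "(\<lambda>p. norm ((cmod (\<xi> p))\<^sup>2)) summable_on I"
    by (rule Infinite_Sum.abs_summable_on_comparison_test'[OF assms(2)]) (use assms(3) in auto)
  then have sm: "(\<lambda>p. (cmod (\<xi> p))\<^sup>2) summable_on I"
    by simp
  then show "\<xi> \<in> l2 I" using assms(1) by (simp add: l2_def)
  show "(l2_norm I \<xi>)\<^sup>2 \<le> infsum g I"
    unfolding l2_norm_squared by (rule infsum_mono[OF sm assms(2,3)])
qed

lemma l2_bounded_mult:
  assumes "\<xi> \<in> l2 I" "\<And>p. p \<in> I \<Longrightarrow> cmod (b p) \<le> B"
  shows "(\<lambda>p. b p * \<xi> p) \<in> l2 I" "(l2_norm I (\<lambda>p. b p * \<xi> p))\<^sup>2 \<le> B\<^sup>2 * (l2_norm I \<xi>)\<^sup>2"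
proof -
  have z: "b p * \<xi> p = 0" if "p \<notin> I" for p
    using assms(1) that by (simp add: l2_def)
  have s: "(\<lambda>p. B\<^sup>2 * (cmod (\<xi> p))\<^sup>2) summable_on I"
    using l2_summable[OF assms(1)] by (rule summable_on_cmult_right)
  have le: "(cmod (b p * \<xi> p))\<^sup>2 \<le> B\<^sup>2 * (cmod (\<xi> p))\<^sup>2" if "p \<in> I" for p
    using power_mono[OF assms(2)[OF that], of 2]
    by (simp add: norm_mult power_mult_distrib mult_right_mono)
  show "(\<lambda>p. b p * \<xi> p) \<in> l2 I"
    by (rule l2_dominated(1)[OF z s le])
  show "(l2_norm I (\<lambda>p. b p * \<xi> p))\<^sup>2 \<le> B\<^sup>2 * (l2_norm I \<xi>)\<^sup>2"
    using l2_dominated(2)[OF z s le] by (simp add: infsum_cmult_right' l2_norm_squared)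
qed

lemma l2_add:
  assumes "\<xi> \<in> l2 I" "\<eta> \<in> l2 I"
  shows "(\<lambda>p. \<xi> p + \<eta> p) \<in> l2 I"
    "(l2_norm I (\<lambda>p. \<xi> p + \<eta> p))\<^sup>2 \<le> 2 * (l2_norm I \<xi>)\<^sup>2 + 2 * (l2_norm I \<eta>)\<^sup>2"
proof -
  have z: "\<xi> p + \<eta> p = 0" if "p \<notin> I" for p
    using assms that by (simp add: l2_def)
  have s: "(\<lambda>p. 2 * (cmod (\<xi> p))\<^sup>2 + 2 * (cmod (\<eta> p))\<^sup>2) summable_on I"
    by (intro summable_on_add summable_on_cmult_right l2_summable assms)
  have le: "(cmod (\<xi> p + \<eta> p))\<^sup>2 \<le> 2 * (cmod (\<xi> p))\<^sup>2 + 2 * (cmod (\<eta> p))\<^sup>2" for p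
  proof -
    have "(cmod (\<xi> p + \<eta> p))\<^sup>2 \<le> (cmod (\<xi> p) + cmod (\<eta> p))\<^sup>2"
      by (intro power_mono norm_triangle_ineq) auto
    also have "\<dots> \<le> 2 * (cmod (\<xi> p))\<^sup>2 + 2 * (cmod (\<eta> p))\<^sup>2"
      using sum_squares_bound[of "cmod (\<xi> p)" "cmod (\<eta> p)"] by (simp add: power2_sum)
    finally show ?thesis .
  qed
  show "(\<lambda>p. \<xi> p + \<eta> p) \<in> l2 I"
    by (rule l2_dominated(1)[OF z s le])
  show "(l2_norm I (\<lambda>p. \<xi> p + \<eta> p))\<^sup>2 \<le> 2 * (l2_norm I \<xi>)\<^sup>2 + 2 * (l2_norm I \<eta>)\<^sup>2"
    using l2_dominated(2)[OF z s le]
    by (simp add: infsum_add infsum_cmult_right' summable_on_cmult_right l2_summable assms l2_norm_squared)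
qed

text \<open>The weight \<open>t\<close> lets the inner-product bounds below do the work of the Cauchy--Schwarz
  inequality: choosing \<open>t\<close> as small as the error in one argument makes both terms small.\<close>

lemma mult_le_weighted_squares:
  fixes a b t :: real
  assumes "t > 0"
  shows "a * b \<le> (t * a\<^sup>2 + b\<^sup>2 / t) / 2"
proof -
  have "0 \<le> (t * a - b)\<^sup>2 / t"
    using assms by simp
  also have "\<dots> = t * a\<^sup>2 + b\<^sup>2 / t - 2 * (a * b)"
    using assms by (simp add: power2_eq_square field_simps)
  finally show ?thesis by simp
qed

lemma l2_inner_summable:
  assumes "\<xi> \<in> l2 I" "\<eta> \<in> l2 I"
  shows "(\<lambda>p. cmod (\<xi> p * cnj (\<eta> p))) summable_on I"
    "(\<lambda>p. \<xi> p * cnj (\<eta> p)) summable_on I"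
proof -
  show s: "(\<lambda>p. cmod (\<xi> p * cnj (\<eta> p))) summable_on I"
  proof (rule Infinite_Sum.abs_summable_on_comparison_test')
    show "(\<lambda>p. (1 * (cmod (\<xi> p))\<^sup>2 + (cmod (\<eta> p))\<^sup>2 / 1) / 2) summable_on I"
      using summable_on_cmult_left[OF summable_on_add[OF assms[THEN l2_summable]], of "1/2"] by simp
    show "cmod (\<xi> p * cnj (\<eta> p)) \<le> (1 * (cmod (\<xi> p))\<^sup>2 + (cmod (\<eta> p))\<^sup>2 / 1) / 2" for p
      using mult_le_weighted_squares[of 1 "cmod (\<xi> p)" "cmod (\<eta> p)"] by (simp add: norm_mult)
  qed
  then show "(\<lambda>p. \<xi> p * cnj (\<eta> p)) summable_on I"
    by (rule abs_summable_summable)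
qed

lemma l2_inner_bound:
  assumes "\<xi> \<in> l2 I" "\<eta> \<in> l2 I" "t > 0"
  shows "cmod (l2_inner I \<xi> \<eta>) \<le> (t * (l2_norm I \<xi>)\<^sup>2 + (l2_norm I \<eta>)\<^sup>2 / t) / 2"
proof -
  have s: "(\<lambda>p. t / 2 * (cmod (\<xi> p))\<^sup>2) summable_on I" "(\<lambda>p. 1 / (2 * t) * (cmod (\<eta> p))\<^sup>2) summable_on I"
    by (rule summable_on_cmult_right[OF l2_summable[OF assms(1)]] summable_on_cmult_right[OF l2_summable[OF assms(2)]])+
  have "cmod (l2_inner I \<xi> \<eta>) \<le> (\<Sum>\<^sub>\<infinity>p\<in>I. cmod (\<xi> p * cnj (\<eta> p)))"
    unfolding l2_inner_def using l2_inner_summable[OF assms(1,2)] by (intro norm_infsum_bound)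
  also have "\<dots> \<le> (\<Sum>\<^sub>\<infinity>p\<in>I. t / 2 * (cmod (\<xi> p))\<^sup>2 + 1 / (2 * t) * (cmod (\<eta> p))\<^sup>2)"
  proof (intro infsum_mono l2_inner_summable assms summable_on_add s)
    show "cmod (\<xi> p * cnj (\<eta> p)) \<le> t / 2 * (cmod (\<xi> p))\<^sup>2 + 1 / (2 * t) * (cmod (\<eta> p))\<^sup>2" for p
      using mult_le_weighted_squares[OF assms(3), of "cmod (\<xi> p)" "cmod (\<eta> p)"]
      by (simp add: norm_mult add_divide_distrib)
  qed
  also have "\<dots> = t / 2 * (l2_norm I \<xi>)\<^sup>2 + 1 / (2 * t) * (l2_norm I \<eta>)\<^sup>2"
    by (simp only: infsum_add[OF s] infsum_cmult_right' l2_norm_squared)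
  finally show ?thesis by (simp add: field_simps)
qed

lemma l2_inner_commute: "l2_inner I \<eta> \<xi> = cnj (l2_inner I \<xi> \<eta>)"
  by (simp add: l2_inner_def mult.commute flip: infsum_cnj)

lemma l2_inner_add_left:
  assumes "\<xi> \<in> l2 I" "\<xi>' \<in> l2 I" "\<eta> \<in> l2 I"
  shows "l2_inner I (\<lambda>p. \<xi> p + \<xi>' p) \<eta> = l2_inner I \<xi> \<eta> + l2_inner I \<xi>' \<eta>"
  by (simp add: l2_inner_def distrib_right infsum_add l2_inner_summable assms)

lemma l2_inner_scale_left: "l2_inner I (\<lambda>p. c * \<xi> p) \<eta> = c * l2_inner I \<xi> \<eta>"
  by (simp add: l2_inner_def mult.assoc infsum_cmult_right')

lemma l2_inner_add_right:
  assumes "\<xi> \<in> l2 I" "\<eta> \<in> l2 I" "\<eta>' \<in> l2 I"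
  shows "l2_inner I \<xi> (\<lambda>p. \<eta> p + \<eta>' p) = l2_inner I \<xi> \<eta> + l2_inner I \<xi> \<eta>'"
  by (simp add: l2_inner_commute[of I \<xi>] l2_inner_add_left assms)

lemma l2_inner_scale_right: "l2_inner I \<xi> (\<lambda>p. c * \<eta> p) = cnj c * l2_inner I \<xi> \<eta>"
  by (simp add: l2_inner_commute[of I \<xi>] l2_inner_scale_left)

lemma l2_minus:
  assumes "\<xi> \<in> l2 I" "\<eta> \<in> l2 I"
  shows "\<xi> - \<eta> \<in> l2 I"
  using l2_add(1)[OF assms(1) l2_bounded_mult(1)[OF assms(2), of "\<lambda>_. -1" 1]] 
  by (simp add: fun_diff_def)

lemma l2_inner_minus_right:
  assumes "\<xi> \<in> l2 I" "\<eta> \<in> l2 I" "\<eta>' \<in> l2 I"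
  shows "l2_inner I \<xi> (\<eta> - \<eta>') = l2_inner I \<xi> \<eta> - l2_inner I \<xi> \<eta>'"
  using l2_inner_add_right[OF assms(1,2) l2_bounded_mult(1)[OF assms(3), of "\<lambda>_. -1" 1]]
    l2_inner_scale_right[of I \<xi> "-1" \<eta>']
  by (simp add: fun_diff_def)

text \<open>The form in which the weighted bounds are exploited: they produce upper bounds \<open>e * c\<close> for every
  positive \<open>e\<close>.\<close>

lemma le_zero_if_le_small:
  fixes x c :: real
  assumes "\<And>e. e > 0 \<Longrightarrow> x \<le> e * c"
  shows "x \<le> 0"
proof (rule ccontr)
  assume "\<not> x \<le> 0"
  then have "x > 0" by simp
  then have "x \<le> x * (c / (2 * (\<bar>c\<bar> + 1)))"
    using assms[of "x / (2 * (\<bar>c\<bar> + 1))"] by simp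
  also have "\<dots> \<le> x * (1 / 2)"
    using \<open>x > 0\<close> by (intro mult_left_mono) (auto simp: divide_simps)
  finally show False
    using \<open>x > 0\<close> by simp
qed

lemma l2_closed_span_superset:
  assumes "\<xi> \<in> S" "\<xi> \<in> l2 I"
  shows "\<xi> \<in> l2_closed_span I S"
proof -
  interpret vector_space "l2_scale :: complex \<Rightarrow> ('a \<Rightarrow> complex) \<Rightarrow> _"
    by (rule vector_space_l2_scale)
  have "l2_norm I (\<xi> - \<xi>) = 0"
    by (simp add: l2_norm_def)
  then show ?thesis
    unfolding l2_closed_span_def l2_closure_def using assms span_base[OF assms(1)] by force
qed

text \<open>The weighted bound is applied with the approximation error \<open>e\<close> as weight.\<close>

lemma l2_perp_closed_span:
  assumes \<xi>: "\<xi> \<in> l2 I" and S: "S \<subseteq> l2 I" and perp: "l2_perp I \<xi> S"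
  shows "l2_perp I \<xi> (l2_closed_span I S)"
proof -
  interpret vector_space "l2_scale :: complex \<Rightarrow> ('a \<Rightarrow> complex) \<Rightarrow> _"
    by (rule vector_space_l2_scale)
  have span: "\<eta> \<in> l2 I \<and> l2_inner I \<xi> \<eta> = 0" if "\<eta> \<in> span S" for \<eta>
    using that
  proof (induction rule: span_induct_alt)
    case base
    show ?case by (simp add: l2_def l2_inner_def zero_fun_def)
  next
    case (step c \<eta> \<zeta>)
    then have "\<eta> \<in> l2 I" "l2_inner I \<xi> \<eta> = 0"
      using S perp by (auto simp: l2_perp_def)
    then show ?case
      using step(2) l2_bounded_mult(1)[of \<eta> I "\<lambda>_. c" "cmod c"] \<xi>
      by (auto simp: plus_fun_def l2_scale_def l2_add l2_inner_add_right l2_inner_scale_right)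
  qed
  show ?thesis
    unfolding l2_perp_def
  proof
    fix \<eta> assume "\<eta> \<in> l2_closed_span I S"
    then have \<eta>: "\<eta> \<in> l2 I" and lim: "\<And>e. e > 0 \<Longrightarrow> \<exists>\<zeta>\<in>span S. l2_norm I (\<eta> - \<zeta>) < e"
      by (auto simp: l2_closed_span_def l2_closure_def)
    have "cmod (l2_inner I \<xi> \<eta>) \<le> e * (((l2_norm I \<xi>)\<^sup>2 + 1) / 2)" if "e > 0" for e
    proof -
      obtain \<zeta> where \<zeta>: "\<zeta> \<in> span S" "l2_norm I (\<eta> - \<zeta>) < e"
        using lim[OF \<open>e > 0\<close>] by blast
      have "l2_inner I \<xi> \<eta> = l2_inner I \<xi> (\<eta> - \<zeta>)"
        using span[OF \<zeta>(1)] by (simp add: l2_inner_minus_right \<xi> \<eta>)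
      also have "cmod \<dots> \<le> (e * (l2_norm I \<xi>)\<^sup>2 + (l2_norm I (\<eta> - \<zeta>))\<^sup>2 / e) / 2"
        using span[OF \<zeta>(1)] \<open>e > 0\<close> by (intro l2_inner_bound \<xi> l2_minus \<eta>) auto
      also have "(l2_norm I (\<eta> - \<zeta>))\<^sup>2 / e \<le> e\<^sup>2 / e"
        using \<zeta>(2) \<open>e > 0\<close>
        by (intro divide_right_mono power_mono) (auto simp: l2_norm_def infsum_nonneg)
      finally show ?thesis
        using \<open>e > 0\<close> by (simp add: power2_eq_square algebra_simps)
    qed
    then have "cmod (l2_inner I \<xi> \<eta>) \<le> 0"
      by (rule le_zero_if_le_small)
    then show "l2_inner I \<xi> \<eta> = 0" by simp
  qed
qed

section \<open>Square-integrable families of vectors\<close>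

text \<open>Along an enumeration of the countable index set the unordered sum is a sequential limit of finite
  sums.\<close>

lemma borel_measurable_infsum:
  fixes g :: "'i \<Rightarrow> 'b \<Rightarrow> 'c::{banach, second_countable_topology}"
  assumes I: "countable I"
    and meas: "\<And>p. p \<in> I \<Longrightarrow> g p \<in> borel_measurable M"
    and sm: "\<And>r. r \<in> space M \<Longrightarrow> (\<lambda>p. g p r) summable_on I"
  shows "(\<lambda>r. \<Sum>\<^sub>\<infinity>p\<in>I. g p r) \<in> borel_measurable M"
proof (cases "I = {}")
  case False
  define X where "X n = from_nat_into I ` {..n}" for n
  have X: "finite (X n)" "X n \<subseteq> I" for n
    using from_nat_into[OF False] by (auto simp: X_def)
  have lim: "filterlim X (finite_subsets_at_top I) sequentially"
    unfolding filterlim_finite_subsets_at_top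
  proof (intro allI impI)
    fix Y assume Y: "finite Y \<and> Y \<subseteq> I"
    have "\<exists>N. Y \<subseteq> X N"
    proof (intro exI subsetI)
      fix y assume "y \<in> Y"
      then have "y = from_nat_into I (to_nat_on I y)"
        using Y I by (simp add: subset_iff)
      moreover have "to_nat_on I y \<le> Max (to_nat_on I ` Y)"
        using Y \<open>y \<in> Y\<close> by simp
      ultimately show "y \<in> X (Max (to_nat_on I ` Y))"
        by (auto simp: X_def)
    qed
    then obtain N where "Y \<subseteq> X N" by blast
    moreover have "X N \<subseteq> X n" if "n \<ge> N" for n
      using that by (auto simp: X_def)
    ultimately show "\<forall>\<^sub>F n in sequentially. finite (X n) \<and> Y \<subseteq> X n \<and> X n \<subseteq> I"
      using X by (intro eventually_sequentiallyI[of N]) blast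
  qed
  show ?thesis
  proof (rule borel_measurable_LIMSEQ_metric)
    show "(\<lambda>r. \<Sum>p\<in>X n. g p r) \<in> borel_measurable M" for n
      using X(2) by (intro borel_measurable_sum meas) auto
    show "(\<lambda>n. \<Sum>p\<in>X n. g p r) \<longlonglongrightarrow> (\<Sum>\<^sub>\<infinity>p\<in>I. g p r)" if "r \<in> space M" for r
      using has_sum_infsum[OF sm[OF that]] lim unfolding has_sum_def
      by (rule filterlim_compose)
  qed
qed simp

lemma L2_l2: "F \<in> L2 R I \<Longrightarrow> r \<in> R \<Longrightarrow> F r \<in> l2 I"
  by (simp add: L2_def)

lemma L2_integrable_norm: "F \<in> L2 R I \<Longrightarrow> integrable (lebesgue_on R) (\<lambda>r. (l2_norm I (F r))\<^sup>2)"
  by (simp add: L2_def)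

lemma L2_norm_squared: "(L2_norm R I F)\<^sup>2 = (LINT r|lebesgue_on R. (l2_norm I (F r))\<^sup>2)"
  by (simp add: L2_norm_def)

text \<open>Coordinates are inner products with unit vectors.\<close>

lemma L2_coordinate_measurable:
  assumes "F \<in> L2 R I" "p \<in> I"
  shows "(\<lambda>r. F r p) \<in> borel_measurable (lebesgue_on R)"
proof -
  define \<delta> where "\<delta> q = (if q = p then 1 else 0 :: complex)" for q
  have "(\<lambda>q. (cmod (\<delta> q))\<^sup>2) summable_on I"
    by (rule finite_nonzero_values_imp_summable_on, rule finite_subset[of _ "{p}"])
      (auto simp: \<delta>_def)
  then have "\<delta> \<in> l2 I"
    using assms(2) by (auto simp: l2_def \<delta>_def)
  then have "(\<lambda>r. l2_inner I (F r) \<delta>) \<in> borel_measurable (lebesgue_on R)"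
    using assms(1) by (simp add: L2_def)
  moreover have "l2_inner I \<xi> \<delta> = \<xi> p" for \<xi>
  proof -
    have "l2_inner I \<xi> \<delta> = (\<Sum>\<^sub>\<infinity>q\<in>{p}. \<xi> q * cnj (\<delta> q))"
      unfolding l2_inner_def using assms(2) by (intro infsum_cong_neutral) (auto simp: \<delta>_def)
    then show ?thesis by (simp add: \<delta>_def)
  qed
  ultimately show ?thesis by simp
qed

lemma l2_inner_measurable:
  assumes I: "countable I" and "\<And>r. r \<in> R \<Longrightarrow> F r \<in> l2 I" "\<And>r. r \<in> R \<Longrightarrow> G r \<in> l2 I"
    and "\<And>p. p \<in> I \<Longrightarrow> (\<lambda>r. F r p) \<in> borel_measurable (lebesgue_on R)"
    and "\<And>p. p \<in> I \<Longrightarrow> (\<lambda>r. G r p) \<in> borel_measurable (lebesgue_on R)"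
  shows "(\<lambda>r. l2_inner I (F r) (G r)) \<in> borel_measurable (lebesgue_on R)"
  unfolding l2_inner_def
  using assms(2-)
  by (intro borel_measurable_infsum I borel_measurable_times l2_inner_summable(2)
      borel_measurable_continuous_on[OF continuous_on_cnj[OF continuous_on_id]]) auto

text \<open>For a countable index set, measurability of the coordinates already gives weak measurability and
  measurability of the norm.\<close>

lemma L2I:
  assumes I: "countable I" and l2: "\<And>r. r \<in> R \<Longrightarrow> F r \<in> l2 I"
    and meas: "\<And>p. p \<in> I \<Longrightarrow> (\<lambda>r. F r p) \<in> borel_measurable (lebesgue_on R)"
    and g: "integrable (lebesgue_on R) g" "\<And>r. r \<in> R \<Longrightarrow> (l2_norm I (F r))\<^sup>2 \<le> g r"
  shows "F \<in> L2 R I"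
proof -
  have inner: "(\<lambda>r. l2_inner I (F r) \<eta>) \<in> borel_measurable (lebesgue_on R)" if "\<eta> \<in> l2 I" for \<eta>
    using that l2 meas by (intro l2_inner_measurable I) auto
  have "(\<lambda>r. Re (l2_inner I (F r) (F r))) \<in> borel_measurable (lebesgue_on R)"
    by (intro borel_measurable_continuous_on[OF continuous_on_Re[OF continuous_on_id]]
        l2_inner_measurable I l2 meas)
  then have "(\<lambda>r. (l2_norm I (F r))\<^sup>2) \<in> borel_measurable (lebesgue_on R)"
    by (rule measurable_cong[THEN iffD1, rotated]) (use l2 in \<open>simp add: l2_inner_self\<close>)
  then have "integrable (lebesgue_on R) (\<lambda>r. (l2_norm I (F r))\<^sup>2)"
    by (rule Bochner_Integration.integrable_bound[OF g(1)]) (use g(2) in \<open>force intro!: AE_I2\<close>)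
  then show ?thesis
    using l2 inner by (simp add: L2_def)
qed

lemma L2_bounded_mult:
  assumes I: "countable I" and F: "F \<in> L2 R I"
    and meas: "\<And>p. p \<in> I \<Longrightarrow> b p \<in> borel_measurable (lebesgue_on R)"
    and bound: "\<And>p r. p \<in> I \<Longrightarrow> r \<in> R \<Longrightarrow> cmod (b p r) \<le> B"
  shows "(\<lambda>r p. b p r * F r p) \<in> L2 R I"
    "(L2_norm R I (\<lambda>r p. b p r * F r p))\<^sup>2 \<le> B\<^sup>2 * (L2_norm R I F)\<^sup>2"
proof -
  have l2: "(\<lambda>p. b p r * F r p) \<in> l2 I"
    and le: "(l2_norm I (\<lambda>p. b p r * F r p))\<^sup>2 \<le> B\<^sup>2 * (l2_norm I (F r))\<^sup>2" if "r \<in> R" for r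
    using l2_bounded_mult[OF L2_l2[OF F that], of "\<lambda>p. b p r" B] bound that by auto
  have int: "integrable (lebesgue_on R) (\<lambda>r. B\<^sup>2 * (l2_norm I (F r))\<^sup>2)"
    by (intro integrable_mult_right L2_integrable_norm F)
  show bF: "(\<lambda>r p. b p r * F r p) \<in> L2 R I"
    by (rule L2I[OF I l2 _ int le])
      (assumption | intro borel_measurable_times meas L2_coordinate_measurable[OF F])+
  have "(L2_norm R I (\<lambda>r p. b p r * F r p))\<^sup>2 \<le> (LINT r|lebesgue_on R. B\<^sup>2 * (l2_norm I (F r))\<^sup>2)"
    unfolding L2_norm_squared
    by (rule integral_mono[OF L2_integrable_norm[OF bF] int]) (use le in simp)
  then show "(L2_norm R I (\<lambda>r p. b p r * F r p))\<^sup>2 \<le> B\<^sup>2 * (L2_norm R I F)\<^sup>2"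
    by (simp add: L2_norm_squared)
qed

lemma L2_minus:
  assumes I: "countable I" and F: "F \<in> L2 R I" and G: "G \<in> L2 R I"
  shows "F - G \<in> L2 R I"
proof (rule L2I[OF I])
  fix r assume r: "r \<in> R"
  have minus: "(\<lambda>p. - 1 * G r p) \<in> l2 I" "(l2_norm I (\<lambda>p. - 1 * G r p))\<^sup>2 \<le> 1\<^sup>2 * (l2_norm I (G r))\<^sup>2"
    using l2_bounded_mult[OF L2_l2[OF G r], of "\<lambda>_. - 1" 1] by auto
  show "(F - G) r \<in> l2 I"
    using l2_minus[OF L2_l2[OF F r] L2_l2[OF G r]] by simp
  show "(l2_norm I ((F - G) r))\<^sup>2 \<le> 2 * (l2_norm I (F r))\<^sup>2 + 2 * (l2_norm I (G r))\<^sup>2"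
    using l2_add(2)[OF L2_l2[OF F r] minus(1)] minus(2) by (simp add: fun_diff_def)
next
  show "integrable (lebesgue_on R) (\<lambda>r. 2 * (l2_norm I (F r))\<^sup>2 + 2 * (l2_norm I (G r))\<^sup>2)"
    by (intro Bochner_Integration.integrable_add integrable_mult_right L2_integrable_norm F G)
next
  show "(\<lambda>r. (F - G) r p) \<in> borel_measurable (lebesgue_on R)" if "p \<in> I" for p
    using borel_measurable_diff[OF L2_coordinate_measurable[OF F that] L2_coordinate_measurable[OF G that]]
    by simp
qed

lemma L2_inner_integrable:
  assumes I: "countable I" and F: "F \<in> L2 R I" and G: "G \<in> L2 R I"
  shows "integrable (lebesgue_on R) (\<lambda>r. l2_inner I (F r) (G r))"
proof (rule Bochner_Integration.integrable_bound)
  show "integrable (lebesgue_on R) (\<lambda>r. (1 * (l2_norm I (F r))\<^sup>2 + (l2_norm I (G r))\<^sup>2 / 1) / 2)"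
    using F G by (auto intro!: L2_integrable_norm)
  show "(\<lambda>r. l2_inner I (F r) (G r)) \<in> borel_measurable (lebesgue_on R)"
    by (intro l2_inner_measurable I L2_l2[OF F] L2_l2[OF G] L2_coordinate_measurable[OF F]
        L2_coordinate_measurable[OF G])
  show "AE r in lebesgue_on R. cmod (l2_inner I (F r) (G r)) \<le>
      norm ((1 * (l2_norm I (F r))\<^sup>2 + (l2_norm I (G r))\<^sup>2 / 1) / 2)"
    by (rule AE_I2) (use l2_inner_bound[OF L2_l2[OF F] L2_l2[OF G], of _ _ 1] in simp)
qed

lemma L2_inner_bound:
  assumes I: "countable I" and F: "F \<in> L2 R I" and G: "G \<in> L2 R I" and t: "t > 0"
  shows "cmod (L2_inner R I F G) \<le> (t * (L2_norm R I F)\<^sup>2 + (L2_norm R I G)\<^sup>2 / t) / 2"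
proof -
  have "cmod (L2_inner R I F G) \<le> (LINT r|lebesgue_on R. cmod (l2_inner I (F r) (G r)))"
    unfolding L2_inner_def by simp
  also have "\<dots> \<le> (LINT r|lebesgue_on R. (t * (l2_norm I (F r))\<^sup>2 + (l2_norm I (G r))\<^sup>2 / t) / 2)"
  proof (rule integral_mono)
    show "integrable (lebesgue_on R) (\<lambda>r. cmod (l2_inner I (F r) (G r)))"
      by (intro integrable_norm L2_inner_integrable I F G)
    show "integrable (lebesgue_on R) (\<lambda>r. (t * (l2_norm I (F r))\<^sup>2 + (l2_norm I (G r))\<^sup>2 / t) / 2)"
      by (intro integrable_divide Bochner_Integration.integrable_add integrable_mult_right
          L2_integrable_norm F G)
  qed (use l2_inner_bound[OF L2_l2[OF F] L2_l2[OF G] t] in simp)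
  also have "\<dots> = (t * (L2_norm R I F)\<^sup>2 + (L2_norm R I G)\<^sup>2 / t) / 2"
    using F G by (simp add: L2_norm_squared L2_integrable_norm)
  finally show ?thesis .
qed

lemma L2_inner_self:
  assumes "F \<in> L2 R I"
  shows "L2_inner R I F F = of_real ((L2_norm R I F)\<^sup>2)"
proof -
  have "L2_inner R I F F = (LINT r|lebesgue_on R. complex_of_real ((l2_norm I (F r))\<^sup>2))"
    unfolding L2_inner_def
    by (intro Bochner_Integration.integral_cong l2_inner_self L2_l2[OF assms]) auto
  then show ?thesis
    unfolding L2_norm_squared by (simp only: integral_complex_of_real)
qed

lemma L2_inner_commute: "L2_inner R I G F = cnj (L2_inner R I F G)"
  by (simp add: L2_inner_def l2_inner_commute[of I _ "G _"] flip: integral_cnj)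

lemma L2_inner_minus_right:
  assumes I: "countable I" and F: "F \<in> L2 R I" and G: "G \<in> L2 R I" and H: "H \<in> L2 R I"
  shows "L2_inner R I F (G - H) = L2_inner R I F G - L2_inner R I F H"
proof -
  have "L2_inner R I F (G - H) = (LINT r|lebesgue_on R. l2_inner I (F r) (G r) - l2_inner I (F r) (H r))"
    unfolding L2_inner_def
    by (intro Bochner_Integration.integral_cong) (simp_all add: l2_inner_minus_right L2_l2[OF F] L2_l2[OF G] L2_l2[OF H])
  then show ?thesis
    by (simp add: L2_inner_def L2_inner_integrable I F G H)
qed

text \<open>For \<open>F \<in> W\<close> pick \<open>\<Phi> \<in> A\<close> close to \<open>F\<close> and put \<open>D = F - f \<Phi> \<in> W\<close>. As \<open>\<Phi> - f \<Phi>\<close> is orthogonal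
  to \<open>D\<close>, the squared norm of \<open>D\<close> is the inner product of \<open>D\<close> with \<open>F - \<Phi>\<close>, so \<open>D\<close> is at most as
  long as \<open>F - \<Phi>\<close>. Since \<open>G\<close> is orthogonal to \<open>f \<Phi>\<close>, its inner product with \<open>F\<close> equals that
  with \<open>D\<close>, which is small.\<close>

lemma L2_orth_if_orth_projections:
  fixes R :: "'a::euclidean_space set" and I :: "'i set"
  assumes I: "countable I" and W: "L2_closed_subspace R I W" and A: "L2_dense R I A"
    and f: "\<And>\<Phi>. \<Phi> \<in> A \<Longrightarrow> f \<Phi> \<in> L2_proj R I W \<Phi>"
    and G: "G \<in> L2 R I" and orth: "\<And>\<Phi>. \<Phi> \<in> A \<Longrightarrow> L2_inner R I G (f \<Phi>) = 0"
  shows "G \<in> L2_orth R I W"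
proof -
  interpret vector_space "L2_scale :: complex \<Rightarrow> ('a \<Rightarrow> 'i \<Rightarrow> complex) \<Rightarrow> _"
    by (rule vector_space_L2_scale)
  have WL2: "W \<subseteq> L2 R I" and sub: "subspace W"
    using W by (auto simp: L2_closed_subspace_def)
  have "L2_inner R I G F = 0" if F: "F \<in> W" for F
  proof -
    have "cmod (L2_inner R I G F) \<le> e * (((L2_norm R I G)\<^sup>2 + 1) / 2)" if "e > 0" for e
    proof -
      have FL2: "F \<in> L2 R I" using F WL2 by blast
      then have "F \<in> L2_closure R I A"
        using A by (simp add: L2_dense_def)
      then obtain \<Phi> where \<Phi>: "\<Phi> \<in> A" "L2_norm R I (F - \<Phi>) < e"
        using \<open>e > 0\<close> by (auto simp: L2_closure_def)
      have \<Phi>L2: "\<Phi> \<in> L2 R I" using A \<Phi>(1) by (auto simp: L2_dense_def)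
      have proj: "f \<Phi> \<in> W" "\<Phi> - f \<Phi> \<in> L2 R I" "\<And>H. H \<in> W \<Longrightarrow> L2_inner R I (\<Phi> - f \<Phi>) H = 0"
        using f[OF \<Phi>(1)] by (auto simp: L2_proj_def L2_orth_def)
      have fL2: "f \<Phi> \<in> L2 R I" using proj(1) WL2 by blast
      define D where "D = F - f \<Phi>"
      have D: "D \<in> W" unfolding D_def using F proj(1) by (rule subspace_diff[OF sub])
      then have DL2: "D \<in> L2 R I" using WL2 by blast
      have FP: "F - \<Phi> \<in> L2 R I" by (intro L2_minus I FL2 \<Phi>L2)
      have "L2_inner R I D (\<Phi> - f \<Phi>) = 0"
        using proj(3)[OF D] by (simp add: L2_inner_commute[of R I D])
      moreover have "F - \<Phi> = D - (\<Phi> - f \<Phi>)"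
        by (simp add: D_def)
      ultimately have "L2_inner R I D (F - \<Phi>) = of_real ((L2_norm R I D)\<^sup>2)"
        by (simp only: L2_inner_minus_right[OF I DL2 DL2 proj(2)] L2_inner_self[OF DL2] diff_zero)
      then have "(L2_norm R I D)\<^sup>2 = cmod (L2_inner R I D (F - \<Phi>))"
        by (simp add: norm_power)
      also have "\<dots> \<le> (1 * (L2_norm R I D)\<^sup>2 + (L2_norm R I (F - \<Phi>))\<^sup>2 / 1) / 2"
        by (rule L2_inner_bound[OF I DL2 FP]) simp
      finally have "(L2_norm R I D)\<^sup>2 \<le> (L2_norm R I (F - \<Phi>))\<^sup>2"
        by simp
      also have "\<dots> \<le> e\<^sup>2"
        using \<Phi>(2) by (intro power_mono) (auto simp: L2_norm_def)
      finally have De: "(L2_norm R I D)\<^sup>2 / e \<le> e\<^sup>2 / e"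
        using \<open>e > 0\<close> by (intro divide_right_mono) auto
      have "L2_inner R I G F = L2_inner R I G D"
        using orth[OF \<Phi>(1)] by (simp add: D_def L2_inner_minus_right I G FL2 fL2)
      also have "cmod \<dots> \<le> (e * (L2_norm R I G)\<^sup>2 + (L2_norm R I D)\<^sup>2 / e) / 2"
        by (rule L2_inner_bound[OF I G DL2 \<open>e > 0\<close>])
      finally show ?thesis
        using De \<open>e > 0\<close> by (simp add: power2_eq_square algebra_simps)
    qed
    then have "cmod (L2_inner R I G F) \<le> 0"
      by (rule le_zero_if_le_small)
    then show ?thesis by simp
  qed
  then show ?thesis using G by (simp add: L2_orth_def)
qed

section \<open>Vanishing of Fourier coefficients along point-group orbits\<close>

text \<open>For \<open>t = chi x\<close> with \<open>x\<close> in the lattice this is the action of the translation \<open>[x, id]\<close>; a general \<open>t\<close>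
  is a multiplier on the union of the sets \<open>M R\<close>, pulled back to \<open>R\<close>.\<close>

definition orbit_mult ::
    "(real ^ 'n::finite \<Rightarrow> complex) \<Rightarrow> (real ^ 'n \<Rightarrow> (real ^ 'n ^ 'n) \<times> 'j \<Rightarrow> complex)
      \<Rightarrow> real ^ 'n \<Rightarrow> (real ^ 'n ^ 'n) \<times> 'j \<Rightarrow> complex" where
  "orbit_mult t G = (\<lambda>r p. t (fst p *v r) * G r p)"

lemma orbit_mult_L2:
  assumes I: "countable I" and R: "R \<in> sets lebesgue" and G: "G \<in> L2 R I"
    and t: "continuous_on UNIV t" "\<And>u. cmod (t u) \<le> B"
  shows "orbit_mult t G \<in> L2 R I" "(L2_norm R I (orbit_mult t G))\<^sup>2 \<le> B\<^sup>2 * (L2_norm R I G)\<^sup>2"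
proof -
  have meas: "(\<lambda>r. t (fst p *v r)) \<in> borel_measurable (lebesgue_on R)" for p
    by (intro continuous_imp_measurable_on_sets_lebesgue R continuous_on_compose2[OF t(1)]
        linear_continuous_on matrix_vector_mul_bounded_linear) auto
  show "orbit_mult t G \<in> L2 R I" "(L2_norm R I (orbit_mult t G))\<^sup>2 \<le> B\<^sup>2 * (L2_norm R I G)\<^sup>2"
    unfolding orbit_mult_def
    using L2_bounded_mult[OF I G, of "\<lambda>p r. t (fst p *v r)" B] meas t(2) by auto
qed

lemma orbit_mult_trig_poly_null:
  assumes I: "countable I" and R: "R \<in> sets lebesgue" and G: "G \<in> L2 R I" and \<Psi>: "\<Psi> \<in> L2 R I"
    and null: "\<And>x. x \<in> L \<Longrightarrow> L2_inner R I (orbit_mult (chi x) G) \<Psi> = 0"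
    and t: "t \<in> trig_poly L"
  shows "L2_inner R I (orbit_mult t G) \<Psi> = 0"
  using t
proof induction
  case (chi x)
  then show ?case by (rule null)
next
  case (scale t c)
  have "l2_inner I (orbit_mult (\<lambda>u. c * t u) G r) (\<Psi> r) = c * l2_inner I (orbit_mult t G r) (\<Psi> r)" for r
    by (simp add: orbit_mult_def mult.assoc l2_inner_scale_left)
  then show ?case
    using scale.IH by (simp add: L2_inner_def)
next
  case (add s t)
  have L2: "orbit_mult s G \<in> L2 R I" "orbit_mult t G \<in> L2 R I"
    using bounded_trig_poly[OF add.hyps(1)] bounded_trig_poly[OF add.hyps(2)]
      orbit_mult_L2(1)[OF I R G continuous_trig_poly[OF add.hyps(1)]]
      orbit_mult_L2(1)[OF I R G continuous_trig_poly[OF add.hyps(2)]] by blast+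
  have "L2_inner R I (orbit_mult (\<lambda>u. s u + t u) G) \<Psi> =
      (LINT r|lebesgue_on R. l2_inner I (orbit_mult s G r) (\<Psi> r) + l2_inner I (orbit_mult t G r) (\<Psi> r))"
    unfolding L2_inner_def
  proof (rule Bochner_Integration.integral_cong[OF refl])
    fix r assume "r \<in> space (lebesgue_on R)"
    then have r: "r \<in> R" by simp
    show "l2_inner I (orbit_mult (\<lambda>u. s u + t u) G r) (\<Psi> r) =
        l2_inner I (orbit_mult s G r) (\<Psi> r) + l2_inner I (orbit_mult t G r) (\<Psi> r)"
      using l2_inner_add_left[OF L2_l2[OF L2(1) r] L2_l2[OF L2(2) r] L2_l2[OF \<Psi> r]]
      by (simp add: orbit_mult_def distrib_right)
  qed
  also have "\<dots> = L2_inner R I (orbit_mult s G) \<Psi> + L2_inner R I (orbit_mult t G) \<Psi>"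
    unfolding L2_inner_def
    by (intro Bochner_Integration.integral_add L2_inner_integrable I L2 \<Psi>)
  finally show ?case
    using add.IH by simp
qed

text \<open>A uniform error \<open>e\<close> in the multiplier costs an error of order \<open>e\<close> in the integral.\<close>

lemma orbit_mult_uniform_limit_null:
  assumes I: "countable I" and R: "R \<in> sets lebesgue" and G: "G \<in> L2 R I" and \<Psi>: "\<Psi> \<in> L2 R I"
    and null: "\<And>t. t \<in> T \<Longrightarrow> L2_inner R I (orbit_mult t G) \<Psi> = 0"
    and T: "\<And>t. t \<in> T \<Longrightarrow> continuous_on UNIV t"
    and q: "continuous_on UNIV q" "\<And>u. cmod (q u) \<le> B"
    and approx: "\<And>e. e > 0 \<Longrightarrow> \<exists>t\<in>T. \<forall>u. cmod (t u - q u) < e"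
  shows "L2_inner R I (orbit_mult q G) \<Psi> = 0"
proof -
  have "cmod (L2_inner R I (orbit_mult q G) \<Psi>) \<le> e * (((L2_norm R I G)\<^sup>2 + (L2_norm R I \<Psi>)\<^sup>2) / 2)"
    if e: "e > 0" for e
  proof -
    obtain t where t: "t \<in> T" "\<And>u. cmod (t u - q u) < e"
      using approx[OF e] by blast
    have ct: "continuous_on UNIV t" by (rule T[OF t(1)])
    have bt: "cmod (t u) \<le> B + e" for u
      using norm_triangle_ineq[of "q u" "t u - q u"] q(2)[of u] t(2)[of u] by simp
    define s where "s u = t u - q u" for u
    have sL2: "orbit_mult s G \<in> L2 R I" "(L2_norm R I (orbit_mult s G))\<^sup>2 \<le> e\<^sup>2 * (L2_norm R I G)\<^sup>2"
      using orbit_mult_L2[OF I R G, of s e] t(2) continuous_on_diff[OF ct q(1)]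
      by (auto simp: s_def[abs_def] less_imp_le)
    have qL2: "orbit_mult q G \<in> L2 R I"
      by (rule orbit_mult_L2(1)[OF I R G q])
    have "orbit_mult t G - orbit_mult q G = orbit_mult s G"
      by (auto simp: orbit_mult_def s_def left_diff_distrib fun_eq_iff)
    then have "L2_inner R I \<Psi> (orbit_mult s G) =
        L2_inner R I \<Psi> (orbit_mult t G) - L2_inner R I \<Psi> (orbit_mult q G)"
      using L2_inner_minus_right[OF I \<Psi> orbit_mult_L2(1)[OF I R G ct bt] qL2] by simp
    then have "L2_inner R I (orbit_mult q G) \<Psi> = - cnj (L2_inner R I \<Psi> (orbit_mult s G))"
      using null[OF t(1)] by (simp add: L2_inner_commute[of R I _ \<Psi>])
    then have "cmod (L2_inner R I (orbit_mult q G) \<Psi>) = cmod (L2_inner R I \<Psi> (orbit_mult s G))"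
      by simp
    also have "\<dots> \<le> (e * (L2_norm R I \<Psi>)\<^sup>2 + (L2_norm R I (orbit_mult s G))\<^sup>2 / e) / 2"
      by (rule L2_inner_bound[OF I \<Psi> sL2(1) e])
    also have "\<dots> \<le> (e * (L2_norm R I \<Psi>)\<^sup>2 + e\<^sup>2 * (L2_norm R I G)\<^sup>2 / e) / 2"
      using sL2(2) e by (intro divide_right_mono add_left_mono) auto
    also have "\<dots> = e * (((L2_norm R I G)\<^sup>2 + (L2_norm R I \<Psi>)\<^sup>2) / 2)"
      using e by (simp add: power2_eq_square algebra_simps)
    finally show ?thesis .
  qed
  then have "cmod (L2_inner R I (orbit_mult q G) \<Psi>) \<le> 0"
    by (rule le_zero_if_le_small)
  then show ?thesis by simp
qed

text \<open>Inner regularity, with the compact sets made increasing so that a point of \<open>E\<close> outside the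
  null set lies in all but finitely many of them.\<close>

lemma incseq_compact_exhaustion:
  fixes E :: "'a::euclidean_space set"
  assumes "E \<in> sets lebesgue"
  obtains C :: "nat \<Rightarrow> 'a set" and N where
    "\<And>j. compact (C j)" "\<And>j. C j \<subseteq> E" "negligible N"
    "\<And>r. r \<in> E - N \<Longrightarrow> \<forall>\<^sub>F j in sequentially. r \<in> C j"
proof -
  obtain N K where NK: "negligible N" "\<And>n::nat. compact (K n)" "E = (\<Union>n. K n) \<union> N"
    using lebesgue_regular_inner[OF assms] by blast
  show thesis
  proof
    show "compact (\<Union>n\<le>j. K n)" "(\<Union>n\<le>j. K n) \<subseteq> E" for j
      using NK by auto
    show "negligible N" by (rule NK)
    fix r assume "r \<in> E - N"
    then obtain n where "r \<in> K n" using NK(3) by blast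
    then show "\<forall>\<^sub>F j in sequentially. r \<in> (\<Union>n\<le>j. K n)"
      by (intro eventually_sequentiallyI[of n]) auto
  qed
qed

lemma AE_zero_if_set_integrals_zero:
  fixes h :: "'a \<Rightarrow> complex"
  assumes h: "integrable M h"
    and null: "\<And>E. E \<in> sets M \<Longrightarrow> (LINT r|M. indicator E r * h r) = 0"
  shows "AE r in M. h r = 0"
proof -
  have part: "AE r in M. g (h r) = 0" if g: "bounded_linear g" for g :: "complex \<Rightarrow> real"
  proof (rule density_unique_real)
    show "integrable M (\<lambda>r. g (h r))"
      by (rule integrable_bounded_linear[OF g h])
    fix E assume E: "E \<in> sets M"
    have int: "integrable M (\<lambda>r. indicator E r * h r)"
      using integrable_mult_indicator[OF E h] by (simp add: scaleR_conv_of_real of_real_indicator)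
    have "(LINT r:E|M. g (h r)) = (LINT r|M. g (indicator E r * h r))"
      unfolding set_lebesgue_integral_def
      by (intro Bochner_Integration.integral_cong)
        (auto simp: indicator_def linear_0[OF bounded_linear.linear[OF g]])
    also have "\<dots> = g (LINT r|M. indicator E r * h r)"
      by (rule integral_bounded_linear[OF g int])
    finally show "(LINT r:E|M. g (h r)) = (LINT r:E|M. 0)"
      using null[OF E] linear_0[OF bounded_linear.linear[OF g]] by simp
  qed auto
  show ?thesis
    using part[OF bounded_linear_Re] part[OF bounded_linear_Im]
    by eventually_elim (simp add: complex_eq_iff)
qed

text \<open>Uniqueness of Fourier coefficients for the integrable function that equals
  \<open>\<Sum>\<^sub>z G(r)(M, z) cnj (\<Psi>(r)(M, z))\<close> at \<open>M r\<close>. For measurable \<open>E \<subseteq> R\<close> the multiplier that is \<open>1\<close> on the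
  orbits of \<open>E\<close> and \<open>0\<close> on those of \<open>R - E\<close> is an almost everywhere limit of separating functions for
  compact pieces; the hypothesis \<open>sep\<close> says that such pieces have no common point modulo the
  dual lattice.\<close>

lemma AE_orthogonal_if_orbit_chi_null:
  fixes R :: "(real ^ 'n::finite) set" and P :: "(real ^ 'n ^ 'n) set" and J :: "'j set"
  assumes P: "finite P" and J: "countable J" and R: "R \<in> sets lebesgue"
    and L: "0 \<in> L" "\<And>x y. x \<in> L \<Longrightarrow> y \<in> L \<Longrightarrow> x + y \<in> L" "\<And>x. x \<in> L \<Longrightarrow> - x \<in> L"
    and sep: "\<And>M M' k k'. M \<in> P \<Longrightarrow> M' \<in> P \<Longrightarrow> k \<in> R \<Longrightarrow> k' \<in> R \<Longrightarrow>
      (\<And>x. x \<in> L \<Longrightarrow> x \<bullet> (M *v k - M' *v k') \<in> \<int>) \<Longrightarrow> k = k'"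
    and G: "G \<in> L2 R (P \<times> J)" and \<Psi>: "\<Psi> \<in> L2 R (P \<times> J)"
    and null: "\<And>x. x \<in> L \<Longrightarrow> L2_inner R (P \<times> J) (orbit_mult (chi x) G) \<Psi> = 0"
  shows "AE r in lebesgue_on R. l2_inner (P \<times> J) (G r) (\<Psi> r) = 0"
proof -
  define I where "I = P \<times> J"
  have I: "countable I" using P J by (simp add: I_def countable_finite)
  note G = G[folded I_def] and \<Psi> = \<Psi>[folded I_def] and null = null[folded I_def]
  have int: "integrable (lebesgue_on R) (\<lambda>r. l2_inner I (G r) (\<Psi> r))"
    by (rule L2_inner_integrable[OF I G \<Psi>])
  have "(LINT r|lebesgue_on R. indicator E r * l2_inner I (G r) (\<Psi> r)) = 0"
    if "E \<in> sets (lebesgue_on R)" for E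
  proof -
    have E: "E \<in> sets lebesgue" "R - E \<in> sets lebesgue" "E \<subseteq> R"
      using that R by (auto simp: sets_restrict_space_iff)
    obtain C N where C: "\<And>j. compact (C j)" "\<And>j. C j \<subseteq> E" "negligible N"
        "\<And>r. r \<in> E - N \<Longrightarrow> \<forall>\<^sub>F j in sequentially. r \<in> C j"
      using incseq_compact_exhaustion[OF E(1)] by metis
    obtain D N' where D: "\<And>j. compact (D j)" "\<And>j. D j \<subseteq> R - E" "negligible N'"
        "\<And>r. r \<in> (R - E) - N' \<Longrightarrow> \<forall>\<^sub>F j in sequentially. r \<in> D j"
      using incseq_compact_exhaustion[OF E(2)] by metis
    (* orbits under the point group; compactness uses that P is finite *)
    define PX where "PX X = (\<Union>M\<in>P. (*v) M ` X)" for X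
    have PX: "compact (PX X)" if "compact X" for X
      unfolding PX_def using P that
      by (intro compact_UN compact_continuous_image linear_continuous_on
          matrix_vector_mul_bounded_linear) auto
    define separates where "separates j q \<longleftrightarrow> continuous_on UNIV q \<and> (\<forall>u. 0 \<le> q u \<and> q u \<le> 1) \<and>
        (\<forall>u\<in>PX (C j). q u = 1) \<and> (\<forall>u\<in>PX (D j). q u = 0) \<and>
        (\<forall>e>0. \<exists>t\<in>trig_poly L. \<forall>u. cmod (t u - complex_of_real (q u)) < e)" for j q
    have "\<exists>q. separates j q" for j
    proof -
      have sep_j: "\<exists>x\<in>L. x \<bullet> (c - d) \<notin> \<int>" if cd: "c \<in> PX (C j)" "d \<in> PX (D j)" for c d
      proof (rule ccontr)
        assume *: "\<not> (\<exists>x\<in>L. x \<bullet> (c - d) \<notin> \<int>)"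
        obtain M k M' k' where k: "M \<in> P" "k \<in> C j" "c = M *v k" "M' \<in> P" "k' \<in> D j" "d = M' *v k'"
          using cd by (auto simp: PX_def)
        then have "k \<in> E" "k' \<in> R - E" using C(2) D(2) by blast+
        then have "k = k'"
          using sep[OF k(1,4), of k k'] * k E(3) by blast
        then show False using \<open>k \<in> E\<close> \<open>k' \<in> R - E\<close> by blast
      qed
      obtain q where "continuous_on UNIV q" "\<And>u. 0 \<le> q u" "\<And>u. q u \<le> 1"
        "\<And>u. u \<in> PX (C j) \<Longrightarrow> q u = 1" "\<And>u. u \<in> PX (D j) \<Longrightarrow> q u = 0"
        "\<And>e. e > 0 \<Longrightarrow> \<exists>t\<in>trig_poly L. \<forall>u. cmod (t u - complex_of_real (q u)) < e"
        by (rule trig_poly_Urysohn[OF L PX[OF C(1)[of j]] PX[OF D(1)[of j]] sep_j], assumption+, rule that)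
      then have "separates j q"
        by (simp add: separates_def)
      then show ?thesis by (rule exI[of _ q])
    qed
    then obtain q where "\<And>j. separates j (q j)"
      by metis
    then have q: "\<And>j. continuous_on UNIV (q j)" "\<And>j u. 0 \<le> q j u" "\<And>j u. q j u \<le> 1"
        "\<And>j u. u \<in> PX (C j) \<Longrightarrow> q j u = 1" "\<And>j u. u \<in> PX (D j) \<Longrightarrow> q j u = 0"
        "\<And>j e. e > 0 \<Longrightarrow> \<exists>t\<in>trig_poly L. \<forall>u. cmod (t u - complex_of_real (q j u)) < e"
      by (simp_all add: separates_def)
    define Q where "Q j u = complex_of_real (q j u)" for j u
    have Q: "continuous_on UNIV (Q j)" "cmod (Q j u) \<le> 1" for j u
      unfolding Q_def using q(1-3) by (auto intro!: continuous_on_of_real)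
    have zero: "L2_inner R I (orbit_mult (Q j) G) \<Psi> = 0" for j
      by (rule orbit_mult_uniform_limit_null[OF I R G \<Psi> _ continuous_trig_poly Q])
        (use orbit_mult_trig_poly_null[OF I R G \<Psi> null] q(6) in \<open>auto simp: Q_def\<close>)
    (* the integrals on the left are all 0 *)
    have "(\<lambda>j. LINT r|lebesgue_on R. l2_inner I (orbit_mult (Q j) G r) (\<Psi> r)) \<longlonglongrightarrow>
        (LINT r|lebesgue_on R. indicator E r * l2_inner I (G r) (\<Psi> r))"
    proof (rule integral_dominated_convergence)
      show "(\<lambda>r. indicator E r * l2_inner I (G r) (\<Psi> r)) \<in> borel_measurable (lebesgue_on R)"
        using that int by (intro borel_measurable_times borel_measurable_indicator) auto
      show "(\<lambda>r. l2_inner I (orbit_mult (Q j) G r) (\<Psi> r)) \<in> borel_measurable (lebesgue_on R)" for j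
        by (rule borel_measurable_integrable[OF L2_inner_integrable[OF I orbit_mult_L2(1)[OF I R G Q] \<Psi>]])
      show "integrable (lebesgue_on R) (\<lambda>r. ((l2_norm I (G r))\<^sup>2 + (l2_norm I (\<Psi> r))\<^sup>2) / 2)"
        by (intro integrable_divide Bochner_Integration.integrable_add L2_integrable_norm G \<Psi>)
      show "AE r in lebesgue_on R. cmod (l2_inner I (orbit_mult (Q j) G r) (\<Psi> r))
          \<le> ((l2_norm I (G r))\<^sup>2 + (l2_norm I (\<Psi> r))\<^sup>2) / 2" for j
      proof (rule AE_I2)
        fix r assume "r \<in> space (lebesgue_on R)"
        then have r: "r \<in> R" by simp
        have "orbit_mult (Q j) G r \<in> l2 I" "(l2_norm I (orbit_mult (Q j) G r))\<^sup>2 \<le> 1\<^sup>2 * (l2_norm I (G r))\<^sup>2"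
          unfolding orbit_mult_def
          using l2_bounded_mult[OF L2_l2[OF G r], of "\<lambda>p. Q j (fst p *v r)" 1] Q(2) by auto
        then show "cmod (l2_inner I (orbit_mult (Q j) G r) (\<Psi> r))
            \<le> ((l2_norm I (G r))\<^sup>2 + (l2_norm I (\<Psi> r))\<^sup>2) / 2"
          using l2_inner_bound[of "orbit_mult (Q j) G r" I "\<Psi> r" 1] L2_l2[OF \<Psi> r] by simp
      qed
      have "AE r in lebesgue. r \<notin> N \<union> N'"
        using C(3) D(3) by (intro AE_not_in) (simp add: negligible_iff_null_sets[symmetric])
      then have "AE r in lebesgue_on R. r \<notin> N \<union> N'"
        using R by (auto simp: AE_restrict_space_iff)
      moreover have "AE r in lebesgue_on R. r \<in> R"
        by (rule AE_I2) simp
      ultimately show "AE r in lebesgue_on R. (\<lambda>j. l2_inner I (orbit_mult (Q j) G r) (\<Psi> r)) \<longlonglongrightarrow>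
          indicator E r * l2_inner I (G r) (\<Psi> r)"
      proof eventually_elim
        case (elim r)
        have PXI: "fst p *v r \<in> PX X" if "r \<in> X" "p \<in> I" for p X
          using that by (auto simp: PX_def I_def)
        show ?case
        proof (cases "r \<in> E")
          case True
          then have "\<forall>\<^sub>F j in sequentially. r \<in> C j"
            using C(4) elim by blast
          then have "\<forall>\<^sub>F j in sequentially. l2_inner I (orbit_mult (Q j) G r) (\<Psi> r) =
              indicator E r * l2_inner I (G r) (\<Psi> r)"
          proof eventually_elim
            case (elim j)
            then have "Q j (fst p *v r) = 1" if "p \<in> I" for p
              by (simp add: Q_def q(4)[OF PXI[OF _ that]])
            then show ?case
              using True by (simp add: l2_inner_def orbit_mult_def cong: infsum_cong)
          qed
          then show ?thesis by (rule tendsto_eventually)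
        next
          case False
          then have "\<forall>\<^sub>F j in sequentially. r \<in> D j"
            using D(4) elim by blast
          then have "\<forall>\<^sub>F j in sequentially. l2_inner I (orbit_mult (Q j) G r) (\<Psi> r) =
              indicator E r * l2_inner I (G r) (\<Psi> r)"
          proof eventually_elim
            case (elim j)
            then have "Q j (fst p *v r) = 0" if "p \<in> I" for p
              by (simp add: Q_def q(5)[OF PXI[OF _ that]])
            then show ?case
              using False by (simp add: l2_inner_def orbit_mult_def cong: infsum_cong)
          qed
          then show ?thesis by (rule tendsto_eventually)
        qed
      qed
    qed
    then have "(\<lambda>j. 0) \<longlonglongrightarrow> (LINT r|lebesgue_on R. indicator E r * l2_inner I (G r) (\<Psi> r))"
      using zero by (simp add: L2_inner_def)
    then show ?thesis
      by (simp add: LIMSEQ_const_iff)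
  qed
  then show ?thesis
    using AE_zero_if_set_integrals_zero[OF int] by (simp add: I_def)
qed

section \<open>The point group and the dual lattice\<close>

lemma orthogonal_cancel:
  assumes "orthogonal_matrix (M :: real ^ 'n::finite ^ 'n)"
  shows "M *v (u v* M) = u" "(M *v u) v* M = u"
  using assms
  by (simp_all add: orthogonal_matrix_def matrix_vector_mul_assoc
      flip: transpose_matrix_vector)

lemma inner_matrix_vector:
  "(M *v u) \<bullet> v = u \<bullet> (v v* M)" for M :: "real ^ 'n::finite ^ 'n"
  by (metis dot_lmul_matrix inner_commute)

lemma matrix_inv_orthogonal:
  assumes "orthogonal_matrix (M :: real ^ 'n::finite ^ 'n)"
  shows "matrix_inv M = transpose M"
proof -
  have "matrix_inv M = matrix_inv M ** (M ** transpose M)"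
    using assms by (simp add: orthogonal_matrix_def)
  also have "\<dots> = transpose M"
    by (simp add: matrix_mul_assoc orthogonal_matrix_inv(1)[OF assms])
  finally show ?thesis .
qed

lemma orthogonal_point_group:
  assumes "subgroup \<Gamma> euclidean_group" "M \<in> point_group \<Gamma>"
  shows "orthogonal_matrix M"
  using subgroup.subset[OF assms(1)] assms(2)
  by (auto simp: point_group_def euclidean_group_def)

lemma lattice_of_subgroup:
  fixes \<Gamma> :: "'n::finite aff set"
  assumes \<Gamma>: "subgroup \<Gamma> euclidean_group"
  shows "0 \<in> lattice_of \<Gamma>"
    and "x \<in> lattice_of \<Gamma> \<Longrightarrow> y \<in> lattice_of \<Gamma> \<Longrightarrow> x + y \<in> lattice_of \<Gamma>"
    and "x \<in> lattice_of \<Gamma> \<Longrightarrow> - x \<in> lattice_of \<Gamma>"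
proof -
  have id: "matrix_inv (mat 1 :: real ^ 'n ^ 'n) = mat 1"
    by (simp add: matrix_inv_orthogonal orthogonal_matrix_id)
  show "0 \<in> lattice_of \<Gamma>"
    using subgroup.one_closed[OF \<Gamma>] by (simp add: lattice_of_def euclidean_group_def)
  show "x + y \<in> lattice_of \<Gamma>" if "x \<in> lattice_of \<Gamma>" "y \<in> lattice_of \<Gamma>"
    using subgroup.m_closed[OF \<Gamma>, of "(x, mat 1)" "(y, mat 1)"] that
    by (simp add: lattice_of_def euclidean_group_def id)
  show "- x \<in> lattice_of \<Gamma>" if x: "x \<in> lattice_of \<Gamma>"
  proof -
    have "inv\<^bsub>euclidean_group\<^esub> (x, mat 1) = (- x, mat 1)"
      by (rule group.inv_equality[OF group_euclidean_group])
        (simp_all add: euclidean_group_def id orthogonal_matrix_id)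
    then show ?thesis
      using subgroup.m_inv_closed[OF \<Gamma>, of "(x, mat 1)"] x by (simp add: lattice_of_def)
  qed
qed

text \<open>Conjugating the translation \<open>[x, id]\<close> by an element of \<open>\<Gamma>\<close> with linear part \<open>M\<close> gives the translation
  by \<open>M x\<close>.\<close>

lemma point_group_lattice_invariant:
  fixes \<Gamma> :: "'n::finite aff set"
  assumes \<Gamma>: "subgroup \<Gamma> euclidean_group" and M: "M \<in> point_group \<Gamma>" and x: "x \<in> lattice_of \<Gamma>"
  shows "M *v x \<in> lattice_of \<Gamma>"
proof -
  obtain w where w: "(w, M) \<in> \<Gamma>" using M by (auto simp: point_group_def)
  have car: "\<Gamma> \<subseteq> carrier euclidean_group" by (rule subgroup.subset[OF \<Gamma>])
  have orth: "orthogonal_matrix M" by (rule orthogonal_point_group[OF \<Gamma> M])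
  have id: "matrix_inv (mat 1 :: real ^ 'n ^ 'n) = mat 1"
    by (simp add: matrix_inv_orthogonal orthogonal_matrix_id)
  have x': "(x, mat 1) \<in> \<Gamma>" using x by (simp add: lattice_of_def)
  define h where "h = (w, M) \<otimes>\<^bsub>euclidean_group\<^esub> (x, mat 1) \<otimes>\<^bsub>euclidean_group\<^esub> inv\<^bsub>euclidean_group\<^esub> (w, M)"
  have h: "h \<in> \<Gamma>"
    unfolding h_def by (intro subgroup.m_closed[OF \<Gamma>] subgroup.m_inv_closed[OF \<Gamma>] w x')
  have "(M *v x, mat 1) \<otimes>\<^bsub>euclidean_group\<^esub> (w, M) = (w, M) \<otimes>\<^bsub>euclidean_group\<^esub> (x, mat 1)"
    by (simp add: euclidean_group_def id matrix_inv_orthogonal[OF orth] orthogonal_cancel[OF orth] add.commute)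
  moreover have "(M *v x, mat 1) \<in> carrier euclidean_group"
    by (simp add: euclidean_group_def orthogonal_matrix_id)
  ultimately have "(M *v x, mat 1) = h"
    unfolding h_def
    using w x' car subgroup.m_closed[OF \<Gamma> w x']
    by (subst group.inv_solve_right[OF group_euclidean_group]) auto
  then show ?thesis using h by (simp add: lattice_of_def)
qed

text \<open>If \<open>M k\<close> and \<open>M' k'\<close> agree modulo the dual lattice, then the elements \<open>[0, M]\<close> and \<open>[y, M']\<close> of the
  dual group, with \<open>y\<close> the difference pulled back by \<open>M'\<close>, send \<open>k\<close> and \<open>k'\<close> to the same point; so the
  corresponding translates of \<open>R\<close> meet, and the two group elements coincide.\<close>

lemma fundamental_domain_separates:
  assumes \<Gamma>: "subgroup \<Gamma> euclidean_group" and R: "fundamental_domain (dual_group \<Gamma>) R"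
    and M: "M \<in> point_group \<Gamma>" "M' \<in> point_group \<Gamma>" and k: "k \<in> R" "k' \<in> R"
    and dual: "\<And>x. x \<in> lattice_of \<Gamma> \<Longrightarrow> x \<bullet> (M *v k - M' *v k') \<in> \<int>"
  shows "M = M' \<and> k = k'"
proof -
  have orth: "orthogonal_matrix M" "orthogonal_matrix M'"
    using orthogonal_point_group[OF \<Gamma>] M by auto
  define y where "y = (M *v k - M' *v k') v* M'"
  have "x \<bullet> y \<in> \<int>" if "x \<in> lattice_of \<Gamma>" for x
    using dual[OF point_group_lattice_invariant[OF \<Gamma> M(2) that]] inner_matrix_vector[of M']
    by (simp add: y_def)
  then have y: "(y, M') \<in> dual_group \<Gamma>" "(0, M) \<in> dual_group \<Gamma>"
    using M by (auto simp: dual_group_def dual_lattice_def)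
  have "aff_act (0, M) k = aff_act (y, M') k'"
    by (simp add: aff_act_def y_def matrix_vector_right_distrib orthogonal_cancel[OF orth(2)])
  then have "aff_act (0, M) ` R \<inter> aff_act (y, M') ` R \<noteq> {}"
    using k by blast
  moreover have "disjoint_family_on (\<lambda>g. aff_act g ` R) (dual_group \<Gamma>)"
    using R by (simp add: fundamental_domain_def)
  ultimately have "(0, M) = (y, M')"
    using disjoint_family_onD[OF _ y(2) y(1)] by blast
  then have "M = M'" "y = 0" by auto
  then have "M' *v y = 0" by simp
  then have "M *v k = M *v k'"
    using \<open>M = M'\<close> by (simp add: y_def orthogonal_cancel[OF orth(2)])
  then have "k = k'"
    by (metis orthogonal_cancel(2)[OF orth(1)])
  with \<open>M = M'\<close> show ?thesis by simp
qed

lemma fundamental_domain_ball: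
  assumes "fundamental_domain G R"
  obtains r0 \<epsilon> where "\<epsilon> > 0" "ball r0 \<epsilon> \<subseteq> R" "r0 \<in> R"
proof -
  have "R \<noteq> {}" "open R"
    using assms by (auto simp: fundamental_domain_def)
  then obtain r0 \<epsilon> where "r0 \<in> R" "\<epsilon> > 0" "ball r0 \<epsilon> \<subseteq> R"
    by (meson all_not_in_conv open_contains_ball)
  then show thesis
    by (intro that)
qed

text \<open>The translates of \<open>R\<close> by dual lattice vectors are disjoint, nonempty and open.\<close>

lemma countable_dual_lattice:
  assumes \<Gamma>: "subgroup \<Gamma> euclidean_group" and R: "fundamental_domain (dual_group \<Gamma>) R"
  shows "countable (dual_lattice \<Gamma>)"
proof -
  have one: "mat 1 \<in> point_group \<Gamma>"
    using subgroup.one_closed[OF \<Gamma>] by (auto simp: point_group_def euclidean_group_def)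
  have "R \<noteq> {}" "open R" and disj: "disjoint_family_on (\<lambda>g. aff_act g ` R) (dual_group \<Gamma>)"
    using R by (auto simp: fundamental_domain_def)
  have tr: "(\<lambda>u. u + z) ` R = aff_act (z, mat 1) ` R" for z
    by (simp add: aff_act_def)
  have dis: "((\<lambda>u. u + z) ` R) \<inter> ((\<lambda>u. u + z') ` R) = {}"
    if "z \<in> dual_lattice \<Gamma>" "z' \<in> dual_lattice \<Gamma>" "z \<noteq> z'" for z z'
    unfolding tr using disj that one by (auto simp: disjoint_family_on_def dual_group_def)
  have "countable ((\<lambda>z. (\<lambda>u. u + z) ` R) ` dual_lattice \<Gamma>)"
  proof (rule countable_disjoint_open_subsets)
    show "open S" if "S \<in> (\<lambda>z. (\<lambda>u. u + z) ` R) ` dual_lattice \<Gamma>" for S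
      using that open_translation[OF \<open>open R\<close>] by (auto simp: add.commute)
    show "pairwise disjnt ((\<lambda>z. (\<lambda>u. u + z) ` R) ` dual_lattice \<Gamma>)"
      using dis by (auto simp: pairwise_def disjnt_def)
  qed
  moreover have "inj_on (\<lambda>z. (\<lambda>u. u + z) ` R) (dual_lattice \<Gamma>)"
  proof (rule inj_onI, rule ccontr)
    fix z z' assume "z \<in> dual_lattice \<Gamma>" "z' \<in> dual_lattice \<Gamma>" "z \<noteq> z'"
      "(\<lambda>u. u + z) ` R = (\<lambda>u. u + z') ` R"
    then show False using dis[of z z'] \<open>R \<noteq> {}\<close> by auto
  qed
  ultimately show ?thesis by (rule countable_image_inj_on)
qed

text \<open>The orbit of a point \<open>r0\<close> of \<open>R\<close> lies on a sphere, and its points keep a distance at least \<open>\<epsilon>\<close> if \<open>R\<close>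
  contains the ball of radius \<open>\<epsilon>\<close> around \<open>r0\<close>: a closer pair, rotated back, would put a second
  point of the orbit into \<open>R\<close>.\<close>

lemma finite_point_group:
  fixes \<Gamma> :: "'n::finite aff set"
  assumes \<Gamma>: "subgroup \<Gamma> euclidean_group" and R: "fundamental_domain (dual_group \<Gamma>) R"
  shows "finite (point_group \<Gamma>)"
proof -
  obtain r0 \<epsilon> where r0: "\<epsilon> > 0" "ball r0 \<epsilon> \<subseteq> R" "r0 \<in> R"
    by (rule fundamental_domain_ball[OF R])
  note orth = orthogonal_point_group[OF \<Gamma>]
  have norm_orth: "norm (M *v u) = norm u" if "orthogonal_matrix M" for M :: "real ^ 'n ^ 'n" and u
    using that by (simp add: norm_eq_sqrt_inner inner_matrix_vector orthogonal_cancel)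
  have sep: "M = M'" if M: "M \<in> point_group \<Gamma>" "M' \<in> point_group \<Gamma>" and d: "dist (M *v r0) (M' *v r0) < \<epsilon>"
    for M M'
  proof -
    define k where "k = (M' *v r0) v* M"
    have Mk: "M *v k = M' *v r0"
      by (simp add: k_def orthogonal_cancel orth M)
    have "dist r0 k = norm (M *v (r0 - k))"
      by (simp add: dist_norm norm_orth orth M)
    also have "\<dots> < \<epsilon>"
      using d by (simp add: matrix_vector_mult_diff_distrib Mk dist_norm)
    finally have "k \<in> R" using r0(2) by (auto simp: subset_iff)
    then show ?thesis
      using fundamental_domain_separates[OF \<Gamma> R M \<open>k \<in> R\<close> r0(3)] Mk by simp
  qed
  have "uniform_discrete ((\<lambda>M. M *v r0) ` point_group \<Gamma>)"
    unfolding uniform_discrete_def using sep r0(1) by blast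
  moreover have "bounded ((\<lambda>M. M *v r0) ` point_group \<Gamma>)"
    by (rule boundedI[of _ "norm r0"]) (auto simp: norm_orth orth)
  ultimately have "finite ((\<lambda>M. M *v r0) ` point_group \<Gamma>)"
    using uniform_discrete_finite_iff by blast
  moreover have "inj_on (\<lambda>M. M *v r0) (point_group \<Gamma>)"
    using sep r0(1) by (auto intro!: inj_onI)
  ultimately show ?thesis by (rule finite_imageD)
qed

section \<open>Fibrewise orthogonality for invariant subspaces\<close>

text \<open>At a pure translation the cross-section cancels from the phase.\<close>

lemma tau_rep_translation:
  fixes M :: "real ^ 'n::finite ^ 'n"
  assumes "orthogonal_matrix M"
  shows "tau_rep xs (x, mat 1) F r (M, z) = chi x (M *v r) * F r (M, z)"
proof -
  have "r \<bullet> (x v* M) = x \<bullet> (M *v r)"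
    by (metis inner_commute inner_matrix_vector)
  moreover have "matrix_inv (mat 1 :: real ^ 'n ^ 'n) = mat 1"
    by (simp add: matrix_inv_orthogonal orthogonal_matrix_id)
  ultimately show ?thesis
    by (simp add: tau_rep_def tensor_id_def U_rep_def chi_def matrix_inv_orthogonal[OF assms])
qed

text \<open>The translate of \<open>\<Psi>\<close> by \<open>-x\<close> stays in \<open>W\<close>, and
  conjugation in the second argument of the inner product turns the translation into the multiplier \<open>chi x\<close> on \<open>G\<close>.\<close>

lemma AE_orthogonal_if_L2_orth:
  fixes \<Gamma> :: "'n::finite aff set"
  assumes \<Gamma>: "subgroup \<Gamma> euclidean_group" and R: "fundamental_domain (dual_group \<Gamma>) R"
    and W: "W \<subseteq> L2 R (tensor_index \<Gamma>)" and inv: "tau_invariant \<Gamma> xs W"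
    and G: "G \<in> L2_orth R (tensor_index \<Gamma>) W" and \<Psi>: "\<Psi> \<in> W"
  shows "AE r in lebesgue_on R. l2_inner (tensor_index \<Gamma>) (G r) (\<Psi> r) = 0"
proof (rule AE_orthogonal_if_orbit_chi_null)
  show "finite (point_group \<Gamma>)" "countable (dual_lattice \<Gamma>)"
    using finite_point_group[OF \<Gamma> R] countable_dual_lattice[OF \<Gamma> R] .
  show "R \<in> sets lebesgue"
    using R by (auto simp: fundamental_domain_def)
  show "G \<in> L2 R (tensor_index \<Gamma>)" "\<Psi> \<in> L2 R (tensor_index \<Gamma>)"
    using G W \<Psi> by (auto simp: L2_orth_def)
  show "k = k'" if "M \<in> point_group \<Gamma>" "M' \<in> point_group \<Gamma>" "k \<in> R" "k' \<in> R"
    "\<And>x. x \<in> lattice_of \<Gamma> \<Longrightarrow> x \<bullet> (M *v k - M' *v k') \<in> \<int>" for M M' k k'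
    using fundamental_domain_separates[OF \<Gamma> R that] by simp
  show "L2_inner R (tensor_index \<Gamma>) (orbit_mult (chi x) G) \<Psi> = 0" if x: "x \<in> lattice_of \<Gamma>" for x
  proof -
    have "tau_rep xs (- x, mat 1) \<Psi> \<in> W"
      using inv \<Psi> lattice_of_subgroup(3)[OF \<Gamma> x]
      by (auto simp: tau_invariant_def lattice_of_def)
    then have "L2_inner R (tensor_index \<Gamma>) G (tau_rep xs (- x, mat 1) \<Psi>) = 0"
      using G by (simp add: L2_orth_def)
    moreover have "l2_inner (tensor_index \<Gamma>) (G r) (tau_rep xs (- x, mat 1) \<Psi> r) =
        l2_inner (tensor_index \<Gamma>) (orbit_mult (chi x) G r) (\<Psi> r)" for r
      unfolding l2_inner_def
    proof (rule infsum_cong)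
      fix p assume "p \<in> tensor_index \<Gamma>"
      then obtain M z where p: "p = (M, z)" "M \<in> point_group \<Gamma>" by auto
      show "G r p * cnj (tau_rep xs (- x, mat 1) \<Psi> r p) = orbit_mult (chi x) G r p * cnj (\<Psi> r p)"
        by (simp add: p tau_rep_translation orthogonal_point_group[OF \<Gamma>] orbit_mult_def cnj_chi)
    qed
    ultimately show ?thesis
      by (simp add: L2_inner_def)
  qed
qed (use lattice_of_subgroup[OF \<Gamma>] in auto)

theorem theorem6p3p6:
  fixes \<Gamma> :: "'n::finite aff set"
    and xs :: "real ^ 'n ^ 'n \<Rightarrow> real ^ 'n"
    and R :: "(real ^ 'n) set"
    and W A :: "(real ^ 'n \<Rightarrow> (real ^ 'n ^ 'n) \<times> (real ^ 'n) \<Rightarrow> complex) set"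
    and f :: "(real ^ 'n \<Rightarrow> (real ^ 'n ^ 'n) \<times> (real ^ 'n) \<Rightarrow> complex)
      \<Rightarrow> real ^ 'n \<Rightarrow> (real ^ 'n ^ 'n) \<times> (real ^ 'n) \<Rightarrow> complex"
    and G :: "real ^ 'n \<Rightarrow> (real ^ 'n ^ 'n) \<times> (real ^ 'n) \<Rightarrow> complex"
  assumes "crystallographic \<Gamma>"
    and "cross_section \<Gamma> xs"
    and "fundamental_domain (dual_group \<Gamma>) R"
    and "convex R"
    and "locally_finite_domain (dual_group \<Gamma>) R"
    and "L2_closed_subspace R (tensor_index \<Gamma>) W"
    and "tau_invariant \<Gamma> xs W"
    and "countable A"
    and "L2_dense R (tensor_index \<Gamma>) A"
    and "\<forall>\<Phi>\<in>A. f \<Phi> \<in> L2_proj R (tensor_index \<Gamma>) W \<Phi>"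
    and "G \<in> L2 R (tensor_index \<Gamma>)"
  shows "(G \<in> L2_orth R (tensor_index \<Gamma>) W \<longleftrightarrow>
           (AE r in lebesgue_on R.
              l2_perp (tensor_index \<Gamma>) (G r) (range_function (tensor_index \<Gamma>) f A r))) \<and>
         orthogonality_condition R (tensor_index \<Gamma>) W (range_function (tensor_index \<Gamma>) f A)"
proof -
  have \<Gamma>: "subgroup \<Gamma> euclidean_group"
    using assms(1) by (simp add: crystallographic_def)
  note R = assms(3)
  have W: "W \<subseteq> L2 R (tensor_index \<Gamma>)"
    using assms(6) by (simp add: L2_closed_subspace_def)
  have I: "countable (tensor_index \<Gamma>)"
    using finite_point_group[OF \<Gamma> R] countable_dual_lattice[OF \<Gamma> R] by (simp add: countable_finite)
  have fW: "f \<Phi> \<in> W" if "\<Phi> \<in> A" for \<Phi>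
    using assms(10) that by (auto simp: L2_proj_def)
  have range: "AE r in lebesgue_on R. l2_perp (tensor_index \<Gamma>) (\<xi> r) (range_function (tensor_index \<Gamma>) f A r)"
    if \<xi>: "\<xi> \<in> L2_orth R (tensor_index \<Gamma>) W" for \<xi>
  proof -
    have "AE r in lebesgue_on R. \<forall>\<Phi>\<in>A. l2_inner (tensor_index \<Gamma>) (\<xi> r) (f \<Phi> r) = 0"
      using AE_orthogonal_if_L2_orth[OF \<Gamma> R W assms(7) \<xi>] fW
      by (simp add: AE_ball_countable[OF assms(8)])
    moreover have "AE r in lebesgue_on R. r \<in> R"
      by (rule AE_I2) simp
    ultimately show ?thesis
    proof eventually_elim
      case (elim r)
      have "\<xi> \<in> L2 R (tensor_index \<Gamma>)" using \<xi> by (simp add: L2_orth_def)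
      then show ?case
        unfolding range_function_def
        using elim L2_l2[OF subsetD[OF W fW] \<open>r \<in> R\<close>]
        by (intro l2_perp_closed_span) (auto simp: l2_perp_def L2_l2)
    qed
  qed
  have "G \<in> L2_orth R (tensor_index \<Gamma>) W"
    if AE: "AE r in lebesgue_on R.
      l2_perp (tensor_index \<Gamma>) (G r) (range_function (tensor_index \<Gamma>) f A r)"
  proof (rule L2_orth_if_orth_projections[OF I assms(6,9) _ assms(11)])
    show "f \<Phi> \<in> L2_proj R (tensor_index \<Gamma>) W \<Phi>" if "\<Phi> \<in> A" for \<Phi>
      using assms(10) that by blast
    show "L2_inner R (tensor_index \<Gamma>) G (f \<Phi>) = 0" if \<Phi>: "\<Phi> \<in> A" for \<Phi>
    proof -
      have "AE r in lebesgue_on R. r \<in> R"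
        by (rule AE_I2) simp
      with AE have "AE r in lebesgue_on R. l2_inner (tensor_index \<Gamma>) (G r) (f \<Phi> r) = 0"
      proof eventually_elim
        case (elim r)
        have "f \<Phi> r \<in> l2 (tensor_index \<Gamma>)"
          using L2_l2[OF subsetD[OF W fW[OF \<Phi>]]] elim(2) by blast
        then have "f \<Phi> r \<in> range_function (tensor_index \<Gamma>) f A r"
          unfolding range_function_def using \<Phi> by (intro l2_closed_span_superset) auto
        then show ?case using elim(1) by (simp add: l2_perp_def)
      qed
      then show ?thesis
        unfolding L2_inner_def by (rule integral_eq_zero_AE)
    qed
  qed
  then show ?thesis
    using range by (auto simp: orthogonality_condition_def)
qed

end
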